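(* The map $\tilde p\colon (\bar{\mathbb N}\times \hat{\mathbb Z}/\hat{\mathbb Z}^* )/_\sim\to\Omega$ induced by the map $p\colon\bar{\mathbb N}\times(\hat{\mathbb Z}/\hat{\mathbb Z}^* )\to\Omega$ is a homeomorphism.
   Context: Notation: $\mathbb N=\{0,1,2,\dots\}$, $\mathbb N^\times=\mathbb N\setminus\{0\}$ (multiplicative semigroup), and $\mathbb N\rtimes\mathbb N^\times$ is the semidirect product with $(m,k)(n,l)=(m+kn,kl)$, a subsemigroup of the group $\mathbb Q\rtimes\mathbb Q^*_+$. It is partially ordered by $x\le y$ iff $x^{-1}y\in\mathbb N\rtimes\mathbb N^\times$. The Nica spectrum $\Omega$ is the set of nonempty hereditary directed subsets $\omega\subset\mathbb N\rtimes\mathbb N^\times$ (hereditary: $y\in\omega$, $x\le y$ imply $x\in\omega$; directed: any two elements of $\omega$ have a common upper bound in $\omega$), with the topology of pointwise convergence of characteristic functions: $\omega_n\to\omega$ iff $\mathbf 1_{\omega_n}(x)\to\mathbf 1_\omega(x)$ for every $x\in\mathbb N\rtimes\mathbb N^\times$. $\hat{\mathbb Z}=\prod_p\mathbb Z_p$ (product over all primes), $\hat{\mathbb Z}^*=\prod_p\mathbb Z_p^*$ is its group of invertible elements, acting on $\hat{\mathbb Z}$ by multiplication, and $\hat{\mathbb Z}/\hat{\mathbb Z}^*$ is the orbit space with the quotient topology. For $a\in\hat{\mathbb Z}/\hat{\mathbb Z}^*$ the ideal $a\hat{\mathbb Z}$ is well defined. $\bar{\mathbb N}=\mathbb N\sqcup\hat{\mathbb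 Z}$ (disjoint union) has the topology with base consisting of the singletons in $\mathbb N$ and the sets $\{n\in\mathbb N: n\ge n_0,\ \gamma(n)\in U\}\sqcup U$, where $n_0\in\mathbb N$, $U\subset\hat{\mathbb Z}$ is open, and $\gamma\colon\mathbb N\to\hat{\mathbb Z}$ is the diagonal embedding. The map $p\colon\bar{\mathbb N}\times(\hat{\mathbb Z}/\hat{\mathbb Z}^* )\to\Omega$ is defined as follows. If $r\in\mathbb N\subset\bar{\mathbb N}$ (type A), then $$p(r,a)=\{(m,k)\in\mathbb N\rtimes\mathbb N^\times : a\in k\hat{\mathbb Z}/\hat{\mathbb Z}^*\text{ and } r-m\in k\mathbb N\}.$$ If $r\in\hat{\mathbb Z}\subset\bar{\mathbb N}$ (type B), then $$p(r,a)=\{(m,k)\in\mathbb N\rtimes\mathbb N^\times : a\in k\hat{\mathbb Z}/\hat{\mathbb Z}^*\text{ and } r-m\in k\hat{\mathbb Z}\}.$$ In the type B case $p(r,a)$ depends only on $a$ and on the class of $r$ in $\hat{\mathbb Z}/a\hat{\mathbb Z}$. The equivalence relation $\sim$ identifies points of type B: $(r,a)\sim(r',a')$ iff $a=a'$ and $r-r'\in a\hat{\mathbb Z}$ (points of type A are identified only with themselves). The quotient $(\bar{\mathbb N}\times\hat{\mathbb Z}/\hat{\mathbb Z}^* )/_\sim=\{(r,a): a\in\hat{\mathbb Z}/\hat{\mathbb Z}^*,\ r\in\mathbb N\sqcup\hat{\mathbb Z}/a\hat{\mathbb Z}\}$ carries the quotient topology, and $\tilde p$ is the map induced by $p$ on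 it. *)

theory Defs
  imports "HOL-Analysis.Analysis" "HOL-Algebra.Ideal" "HOL-Algebra.Group_Action"
begin

section \<open>The profinite integers\<close>

text \<open>
  The ring of \<open>p\<close>-adic integers is the inverse limit of the rings \<open>\<int>/p\<^sup>n\<int>\<close>, the residue
  classes modulo \<open>p\<^sup>n\<close> being represented by \<open>0, \<dots>, p\<^sup>n - 1\<close>.
\<close>

definition Zp :: "nat \<Rightarrow> (nat \<Rightarrow> int) ring" where
  "Zp p = \<lparr>carrier = {x. \<forall>n. x n \<in> {0..<int p ^ n} \<and> x (Suc n) mod int p ^ n = x n},
    monoid.mult = (\<lambda>x y n. (x n * y n) mod int p ^ n),
    one = (\<lambda>n. 1 mod int p ^ n),
    zero = (\<lambda>n. 0),
    add = (\<lambda>x y n. (x n + y n) mod int p ^ n)\<rparr>"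

definition Zp_topology :: "nat \<Rightarrow> (nat \<Rightarrow> int) topology" where
  "Zp_topology p =
     subtopology (product_topology (\<lambda>_. discrete_topology UNIV) UNIV) (carrier (Zp p))"

type_synonym zhat = "nat \<Rightarrow> nat \<Rightarrow> int"

definition Zhat :: "zhat ring" where
  "Zhat = \<lparr>carrier = (\<Pi>\<^sub>E p\<in>{p. prime p}. carrier (Zp p)),
    monoid.mult = (\<lambda>x y. \<lambda>p\<in>{p. prime p}. x p \<otimes>\<^bsub>Zp p\<^esub> y p),
    one = (\<lambda>p\<in>{p. prime p}. \<one>\<^bsub>Zp p\<^esub>),
    zero = (\<lambda>p\<in>{p. prime p}. \<zero>\<^bsub>Zp p\<^esub>),
    add = (\<lambda>x y. \<lambda>p\<in>{p. prime p}. x p \<oplus>\<^bsub>Zp p\<^esub> y p)\<rparr>"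

definition Zhat_topology :: "zhat topology" where
  "Zhat_topology = product_topology Zp_topology {p. prime p}"

text \<open>The diagonal embedding \<open>\<gamma>\<close> of the natural numbers.\<close>

definition diag :: "nat \<Rightarrow> zhat" where
  "diag m = (\<lambda>p\<in>{p. prime p}. \<lambda>n. int m mod int p ^ n)"

lemma mod_power_Suc_mod: "(a :: int) mod (b ^ Suc n) mod b ^ n = a mod b ^ n"
  by (rule mod_mod_cancel) simp

lemma cring_Zp:
  assumes "p > 0"
  shows "cring (Zp p)"
proof (rule cringI)
  have red: "x (Suc n) mod int p ^ n = x n mod int p ^ n" if "x \<in> carrier (Zp p)" for x n
    using that by (auto simp: Zp_def)
  show "abelian_group (Zp p)"
  proof (rule abelian_groupI)
    fix x y assume xy: "x \<in> carrier (Zp p)" "y \<in> carrier (Zp p)"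
    have "(x (Suc n) + y (Suc n)) mod int p ^ n = (x n + y n) mod int p ^ n" for n
      using red[OF xy(1), of n] red[OF xy(2), of n] by (metis mod_add_eq)
    then show "x \<oplus>\<^bsub>Zp p\<^esub> y \<in> carrier (Zp p)"
      using assms unfolding Zp_def
      by (simp add: mod_power_Suc_mod del: power_Suc)
  next
    fix x assume x: "x \<in> carrier (Zp p)"
    have "(- x (Suc n)) mod int p ^ n = (- x n) mod int p ^ n" for n
      using red[OF x, of n] by (metis mod_minus_eq)
    then show "\<exists>y\<in>carrier (Zp p). y \<oplus>\<^bsub>Zp p\<^esub> x = \<zero>\<^bsub>Zp p\<^esub>"
      using assms unfolding Zp_def
      by (intro bexI[of _ "\<lambda>n. (- x n) mod int p ^ n"])
        (auto simp add: mod_power_Suc_mod mod_simps simp del: power_Suc)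
  qed (use assms in \<open>auto simp: Zp_def mod_simps algebra_simps\<close>)
  show "comm_monoid (Zp p)"
  proof (rule comm_monoidI)
    fix x y assume xy: "x \<in> carrier (Zp p)" "y \<in> carrier (Zp p)"
    have "(x (Suc n) * y (Suc n)) mod int p ^ n = (x n * y n) mod int p ^ n" for n
      using red[OF xy(1), of n] red[OF xy(2), of n] by (metis mod_mult_eq)
    then show "x \<otimes>\<^bsub>Zp p\<^esub> y \<in> carrier (Zp p)"
      using assms unfolding Zp_def
      by (simp add: mod_power_Suc_mod del: power_Suc)
  next
    show "\<one>\<^bsub>Zp p\<^esub> \<in> carrier (Zp p)"
      using assms unfolding Zp_def by (simp add: mod_power_Suc_mod del: power_Suc)
  qed (auto simp: Zp_def mod_simps algebra_simps)
qed (auto simp: Zp_def mod_simps algebra_simps)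

lemma cring_Zhat: "cring Zhat"
proof -
  have R: "cring (Zp p)" if "prime p" for p
    using that cring_Zp prime_gt_0_nat by blast
  have mem: "x p \<in> carrier (Zp p)" if "x \<in> (\<Pi>\<^sub>E p\<in>{p. prime p}. carrier (Zp p))" "prime p" for x p
    using that by auto
  have ext: "x = y \<longleftrightarrow> (\<forall>p. x p = y p)" for x y :: zhat
    by (rule fun_eq_iff)
  have arb: "x p = undefined" if "x \<in> (\<Pi>\<^sub>E p\<in>{p. prime p}. carrier (Zp p))" "\<not> prime p" for x p
    using that by auto
  show ?thesis
  proof (rule cringI)
    show "abelian_group Zhat"
    proof (rule abelian_groupI)
      fix x assume x: "x \<in> carrier Zhat"
      have "\<ominus>\<^bsub>Zp p\<^esub> x p \<in> carrier (Zp p)" "\<ominus>\<^bsub>Zp p\<^esub> x p \<oplus>\<^bsub>Zp p\<^esub> x p = \<zero>\<^bsub>Zp p\<^esub>"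
        if "prime p" for p
      proof -
        interpret cring "Zp p" using that by (rule R)
        have "x p \<in> carrier (Zp p)" using x that by (auto simp: Zhat_def)
        then show "\<ominus>\<^bsub>Zp p\<^esub> x p \<in> carrier (Zp p)" "\<ominus>\<^bsub>Zp p\<^esub> x p \<oplus>\<^bsub>Zp p\<^esub> x p = \<zero>\<^bsub>Zp p\<^esub>"
          by (simp_all add: l_neg)
      qed
      then show "\<exists>y\<in>carrier Zhat. y \<oplus>\<^bsub>Zhat\<^esub> x = \<zero>\<^bsub>Zhat\<^esub>"
        by (intro bexI[of _ "\<lambda>p\<in>{p. prime p}. \<ominus>\<^bsub>Zp p\<^esub> x p"])
          (auto simp: Zhat_def intro!: restrict_ext)
    qed (use R in \<open>auto simp: Zhat_def ext mem arb cring.cring_simprules(1,2,8)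
        intro: cring.cring_simprules(7,10)\<close>)
    show "comm_monoid Zhat"
      by (rule comm_monoidI)
        (use R in \<open>auto simp: Zhat_def ext mem arb cring.cring_simprules(5,6,12)
          intro: cring.cring_simprules(11,14)\<close>)
  qed (use R in \<open>auto simp: Zhat_def ext mem arb intro: cring.cring_simprules(13)\<close>)
qed

lemma topspace_Zhat [simp]: "topspace Zhat_topology = carrier Zhat"
  by (simp add: Zhat_topology_def Zhat_def Zp_topology_def)

lemma diag_closed [simp]: "diag m \<in> carrier Zhat"
  by (auto simp: diag_def Zhat_def Zp_def prime_gt_0_nat mod_power_Suc_mod simp del: power_Suc)

section \<open>Quotient topologies and the orbit space\<close>

definition quotient_topology :: "'a topology \<Rightarrow> ('a \<Rightarrow> 'b) \<Rightarrow> 'b topology" where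
  "quotient_topology X f =
     topology (\<lambda>V. V \<subseteq> f ` topspace X \<and> openin X {x \<in> topspace X. f x \<in> V})"

lemma openin_quotient_topology:
  "openin (quotient_topology X f) V \<longleftrightarrow>
     V \<subseteq> f ` topspace X \<and> openin X {x \<in> topspace X. f x \<in> V}"
proof -
  have "istopology (\<lambda>V. V \<subseteq> f ` topspace X \<and> openin X {x \<in> topspace X. f x \<in> V})"
    unfolding istopology_def
  proof (intro conjI allI impI)
    fix S T
    assume "S \<subseteq> f ` topspace X \<and> openin X {x \<in> topspace X. f x \<in> S}"
      and "T \<subseteq> f ` topspace X \<and> openin X {x \<in> topspace X. f x \<in> T}"
    moreover have "{x \<in> topspace X. f x \<in> S \<inter> T} =
        {x \<in> topspace X. f x \<in> S} \<inter> {x \<in> topspace X. f x \<in> T}" by blast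
    ultimately show "S \<inter> T \<subseteq> f ` topspace X" "openin X {x \<in> topspace X. f x \<in> S \<inter> T}"
      by auto
  next
    fix K
    assume K: "\<forall>V\<in>K. V \<subseteq> f ` topspace X \<and> openin X {x \<in> topspace X. f x \<in> V}"
    have "{x \<in> topspace X. f x \<in> \<Union>K} = (\<Union>V\<in>K. {x \<in> topspace X. f x \<in> V})" by blast
    then show "\<Union>K \<subseteq> f ` topspace X" "openin X {x \<in> topspace X. f x \<in> \<Union>K}"
      using K by auto
  qed
  then show ?thesis
    by (simp add: quotient_topology_def)
qed

lemma topspace_quotient_topology [simp]:
  "topspace (quotient_topology X f) = f ` topspace X"
proof
  show "topspace (quotient_topology X f) \<subseteq> f ` topspace X"
    by (metis openin_quotient_topology openin_topspace)
  have "{x \<in> topspace X. f x \<in> f ` topspace X} = topspace X" by blast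
  then have "openin (quotient_topology X f) (f ` topspace X)"
    by (simp add: openin_quotient_topology)
  then show "f ` topspace X \<subseteq> topspace (quotient_topology X f)"
    by (rule openin_subset)
qed

lemma quotient_map_quotient_topology: "quotient_map X (quotient_topology X f) f"
  by (simp add: quotient_map_def openin_quotient_topology)

text \<open>The orbit of \<open>x\<close> under multiplication by the group of units of the ring.\<close>

definition unit_orbit :: "zhat \<Rightarrow> zhat set" where
  "unit_orbit x = Group_Action.orbit (units_of Zhat) (\<lambda>u x. u \<otimes>\<^bsub>Zhat\<^esub> x) x"

definition orbit_topology :: "zhat set topology" where
  "orbit_topology = quotient_topology Zhat_topology unit_orbit"

definition orbit_ideal :: "zhat set \<Rightarrow> zhat set" where
  "orbit_ideal a = a <#>\<^bsub>Zhat\<^esub> carrier Zhat"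

lemma unit_orbit_self:
  assumes "x \<in> carrier Zhat"
  shows "x \<in> unit_orbit x"
proof -
  interpret cring Zhat by (rule cring_Zhat)
  show ?thesis
    using assms by (force simp: unit_orbit_def Group_Action.orbit_def units_of_def)
qed

lemma orbit_ideal_unit_orbit:
  assumes "x \<in> carrier Zhat"
  shows "orbit_ideal (unit_orbit x) = PIdl\<^bsub>Zhat\<^esub> x"
proof -
  interpret cring Zhat by (rule cring_Zhat)
  have "(u \<otimes>\<^bsub>Zhat\<^esub> x) \<otimes>\<^bsub>Zhat\<^esub> z = (u \<otimes>\<^bsub>Zhat\<^esub> z) \<otimes>\<^bsub>Zhat\<^esub> x"
    if "u \<in> carrier Zhat" "z \<in> carrier Zhat" for u z
    using that assms by (simp add: m_ac)
  then have "orbit_ideal (unit_orbit x) \<subseteq> PIdl\<^bsub>Zhat\<^esub> x"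
    by (auto simp: orbit_ideal_def unit_orbit_def Group_Action.orbit_def units_of_def
        set_mult_def cgenideal_def Units_closed)
  moreover have "PIdl\<^bsub>Zhat\<^esub> x \<subseteq> orbit_ideal (unit_orbit x)"
    using unit_orbit_self[OF assms] m_comm[OF _ assms]
    by (fastforce simp: orbit_ideal_def set_mult_def cgenideal_def)
  ultimately show ?thesis by blast
qed

section \<open>The Nica spectrum\<close>

definition NN :: "(nat \<times> nat) set" where
  "NN = UNIV \<times> {0<..}"

text \<open>The group of the pairs \<open>(m, k)\<close> with \<open>m\<close> rational and \<open>k\<close> positive rational.\<close>

definition QQ :: "(rat \<times> rat) monoid" where
  "QQ = \<lparr>carrier = UNIV \<times> {0<..},
    monoid.mult = (\<lambda>(m, k) (n, l). (m + k * n, k * l)),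
    one = (0, 1)\<rparr>"

definition NN_incl :: "nat \<times> nat \<Rightarrow> rat \<times> rat" where
  "NN_incl = (\<lambda>(m, k). (of_nat m, of_nat k))"

definition NN_le :: "nat \<times> nat \<Rightarrow> nat \<times> nat \<Rightarrow> bool" where
  "NN_le x y \<longleftrightarrow> inv\<^bsub>QQ\<^esub> (NN_incl x) \<otimes>\<^bsub>QQ\<^esub> NN_incl y \<in> NN_incl ` NN"

lemma group_QQ: "group QQ"
proof (rule groupI)
  fix x assume "x \<in> carrier QQ"
  then show "\<exists>y\<in>carrier QQ. y \<otimes>\<^bsub>QQ\<^esub> x = \<one>\<^bsub>QQ\<^esub>"
    by (intro bexI[of _ "(- fst x / snd x, 1 / snd x)"]) (auto simp: QQ_def)
qed (auto simp: QQ_def algebra_simps)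

lemma NN_incl_mult:
  "NN_incl (m, k) \<otimes>\<^bsub>QQ\<^esub> NN_incl (n, l) = NN_incl (m + k * n, k * l)"
  by (simp add: NN_incl_def QQ_def)

definition hereditary :: "(nat \<times> nat) set \<Rightarrow> bool" where
  "hereditary \<omega> \<longleftrightarrow> (\<forall>y\<in>\<omega>. \<forall>x\<in>NN. NN_le x y \<longrightarrow> x \<in> \<omega>)"

definition directed :: "(nat \<times> nat) set \<Rightarrow> bool" where
  "directed \<omega> \<longleftrightarrow> (\<forall>x\<in>\<omega>. \<forall>y\<in>\<omega>. \<exists>z\<in>\<omega>. NN_le x z \<and> NN_le y z)"

definition Nica_spectrum :: "(nat \<times> nat) set set" where
  "Nica_spectrum = {\<omega>. \<omega> \<subseteq> NN \<and> \<omega> \<noteq> {} \<and> hereditary \<omega> \<and> directed \<omega>}"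

text \<open>
  Pointwise convergence of characteristic functions, that is, the topology induced from the
  product of discrete two-point spaces.
\<close>

definition Nica_topology :: "(nat \<times> nat) set topology" where
  "Nica_topology = pullback_topology Nica_spectrum (\<lambda>\<omega>. \<lambda>x\<in>NN. x \<in> \<omega>)
     (product_topology (\<lambda>_. discrete_topology (UNIV :: bool set)) NN)"

lemma topspace_Nica [simp]: "topspace Nica_topology = Nica_spectrum"
  by (auto simp: Nica_topology_def topspace_pullback_topology)

section \<open>The parametrization of the Nica spectrum\<close>

text \<open>The disjoint union of the natural numbers and the profinite integers.\<close>

definition Nbar_topology :: "(nat + zhat) topology" where
  "Nbar_topology = topology_generated_by
     (range (\<lambda>n. {Inl n}) \<union>
      {Inl ` {n. n \<ge> n0 \<and> diag n \<in> U} \<union> Inr ` U | n0 U. openin Zhat_topology U})"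

lemma topspace_Nbar [simp]: "topspace Nbar_topology = range Inl \<union> Inr ` carrier Zhat"
proof -
  have "openin Zhat_topology (carrier Zhat)"
    using openin_topspace[of Zhat_topology] by simp
  then have "Inr ` carrier Zhat \<subseteq> topspace Nbar_topology"
    unfolding Nbar_topology_def topology_generated_by_topspace by blast
  moreover have "range Inl \<subseteq> topspace Nbar_topology"
    unfolding Nbar_topology_def topology_generated_by_topspace by auto
  moreover have "topspace Nbar_topology \<subseteq> range Inl \<union> Inr ` carrier Zhat"
    unfolding Nbar_topology_def topology_generated_by_topspace
    by (auto dest!: openin_subset)
  ultimately show ?thesis by blast
qed

definition param_topology :: "((nat + zhat) \<times> zhat set) topology" where
  "param_topology = prod_topology Nbar_topology orbit_topology"

definition Nica_p :: "(nat + zhat) \<times> zhat set \<Rightarrow> (nat \<times> nat) set" where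
  "Nica_p = (\<lambda>(r, a). case r of
     Inl n \<Rightarrow> {(m, k). (m, k) \<in> NN \<and> a \<in> unit_orbit ` (PIdl\<^bsub>Zhat\<^esub> (diag k)) \<and>
       (\<exists>j::nat. int n - int m = int k * int j)}
   | Inr z \<Rightarrow> {(m, k). (m, k) \<in> NN \<and> a \<in> unit_orbit ` (PIdl\<^bsub>Zhat\<^esub> (diag k)) \<and>
       z \<ominus>\<^bsub>Zhat\<^esub> diag m \<in> PIdl\<^bsub>Zhat\<^esub> (diag k)})"

definition param_rel :: "(((nat + zhat) \<times> zhat set) \<times> ((nat + zhat) \<times> zhat set)) set" where
  "param_rel = {(s, t). s \<in> topspace param_topology \<and> t \<in> topspace param_topology \<and>
     (s = t \<or> (\<exists>x y a. s = (Inr x, a) \<and> t = (Inr y, a) \<and> x \<ominus>\<^bsub>Zhat\<^esub> y \<in> orbit_ideal a))}"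

definition param_quotient_topology :: "((nat + zhat) \<times> zhat set) set topology" where
  "param_quotient_topology = quotient_topology param_topology (\<lambda>s. param_rel `` {s})"

text \<open>
  The induced map sends an equivalence class to the common value of \<open>Nica_p\<close> on its
  elements; see \<open>Nica_p_tilde_class\<close> below.
\<close>

definition Nica_p_tilde :: "((nat + zhat) \<times> zhat set) set \<Rightarrow> (nat \<times> nat) set" where
  "Nica_p_tilde C = the_elem (Nica_p ` C)"

lemma topspace_param:
  "topspace param_topology = (range Inl \<union> Inr ` carrier Zhat) \<times> unit_orbit ` carrier Zhat"
  by (simp add: param_topology_def orbit_topology_def)

lemma ideal_orbit_ideal:
  assumes "a \<in> unit_orbit ` carrier Zhat"
  shows "ideal (orbit_ideal a) Zhat"
proof -
  interpret cring Zhat by (rule cring_Zhat)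
  show ?thesis
    using assms by (auto simp: orbit_ideal_unit_orbit cgenideal_ideal)
qed

lemma equiv_param_rel: "equiv (topspace param_topology) param_rel"
proof -
  interpret cring Zhat by (rule cring_Zhat)
  have neg: "y \<ominus>\<^bsub>Zhat\<^esub> x \<in> orbit_ideal a"
    if "x \<ominus>\<^bsub>Zhat\<^esub> y \<in> orbit_ideal a" "a \<in> unit_orbit ` carrier Zhat"
      "x \<in> carrier Zhat" "y \<in> carrier Zhat" for x y a
  proof -
    interpret I: ideal "orbit_ideal a" Zhat using that(2) by (rule ideal_orbit_ideal)
    have "\<ominus>\<^bsub>Zhat\<^esub> (x \<ominus>\<^bsub>Zhat\<^esub> y) \<in> orbit_ideal a" using that(1) by (rule I.a_inv_closed)
    moreover have "\<ominus>\<^bsub>Zhat\<^esub> (x \<ominus>\<^bsub>Zhat\<^esub> y) = y \<ominus>\<^bsub>Zhat\<^esub> x"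
      using that(3,4) by algebra
    ultimately show ?thesis by simp
  qed
  have add: "x \<ominus>\<^bsub>Zhat\<^esub> z \<in> orbit_ideal a"
    if "x \<ominus>\<^bsub>Zhat\<^esub> y \<in> orbit_ideal a" "y \<ominus>\<^bsub>Zhat\<^esub> z \<in> orbit_ideal a"
      "a \<in> unit_orbit ` carrier Zhat"
      "x \<in> carrier Zhat" "y \<in> carrier Zhat" "z \<in> carrier Zhat" for x y z a
  proof -
    interpret I: ideal "orbit_ideal a" Zhat using that(3) by (rule ideal_orbit_ideal)
    have "(x \<ominus>\<^bsub>Zhat\<^esub> y) \<oplus>\<^bsub>Zhat\<^esub> (y \<ominus>\<^bsub>Zhat\<^esub> z) \<in> orbit_ideal a"
      using that(1,2) by (rule I.a_closed)
    moreover have "(x \<ominus>\<^bsub>Zhat\<^esub> y) \<oplus>\<^bsub>Zhat\<^esub> (y \<ominus>\<^bsub>Zhat\<^esub> z) = x \<ominus>\<^bsub>Zhat\<^esub> z"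
      using that(4-6) by algebra
    ultimately show ?thesis by simp
  qed
  show ?thesis
  proof (rule equivI)
    show "sym param_rel"
      unfolding param_rel_def topspace_param by (rule symI) (auto dest: neg)
    show "trans param_rel"
    proof (rule transI)
      fix s t u assume "(s, t) \<in> param_rel" "(t, u) \<in> param_rel"
      then show "(s, u) \<in> param_rel"
        unfolding param_rel_def topspace_param by (auto dest: add)
    qed
  qed (auto simp: param_rel_def refl_on_def)
qed

lemma Nica_p_respects: "Nica_p respects param_rel"
proof (rule congruentI)
  interpret cring Zhat by (rule cring_Zhat)
  have key: "y \<ominus>\<^bsub>Zhat\<^esub> diag m \<in> PIdl\<^bsub>Zhat\<^esub> (diag k)"
    if xy: "x \<ominus>\<^bsub>Zhat\<^esub> y \<in> orbit_ideal a" and a: "a \<in> unit_orbit ` (PIdl\<^bsub>Zhat\<^esub> (diag k))"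
      and x: "x \<ominus>\<^bsub>Zhat\<^esub> diag m \<in> PIdl\<^bsub>Zhat\<^esub> (diag k)"
      and c: "x \<in> carrier Zhat" "y \<in> carrier Zhat" for x y a m k
  proof -
    interpret I: ideal "PIdl\<^bsub>Zhat\<^esub> (diag k)" Zhat by (rule cgenideal_ideal) simp
    obtain b where b: "b \<in> PIdl\<^bsub>Zhat\<^esub> (diag k)" "a = unit_orbit b" using a by blast
    have "x \<ominus>\<^bsub>Zhat\<^esub> y \<in> PIdl\<^bsub>Zhat\<^esub> b"
      using xy b I.Icarr by (simp add: orbit_ideal_unit_orbit)
    then have "x \<ominus>\<^bsub>Zhat\<^esub> y \<in> PIdl\<^bsub>Zhat\<^esub> (diag k)"
      using b(1) by (auto simp: cgenideal_def[of _ b] intro: I.I_l_closed)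
    then have "(x \<ominus>\<^bsub>Zhat\<^esub> diag m) \<ominus>\<^bsub>Zhat\<^esub> (x \<ominus>\<^bsub>Zhat\<^esub> y) \<in> PIdl\<^bsub>Zhat\<^esub> (diag k)"
      using x unfolding a_minus_def[of _ "x \<ominus>\<^bsub>Zhat\<^esub> diag m"]
      by (intro I.a_closed I.a_inv_closed)
    moreover have "(x \<ominus>\<^bsub>Zhat\<^esub> diag m) \<ominus>\<^bsub>Zhat\<^esub> (x \<ominus>\<^bsub>Zhat\<^esub> y) = y \<ominus>\<^bsub>Zhat\<^esub> diag m"
      using c diag_closed[of m] by algebra
    ultimately show ?thesis by simp
  qed
  have sub: "Nica_p s \<subseteq> Nica_p t" if "(s, t) \<in> param_rel" for s t
  proof (cases "s = t")
    case False
    then obtain x y a where st: "s = (Inr x, a)" "t = (Inr y, a)" "x \<ominus>\<^bsub>Zhat\<^esub> y \<in> orbit_ideal a"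
      "x \<in> carrier Zhat" "y \<in> carrier Zhat"
      using \<open>(s, t) \<in> param_rel\<close> by (auto simp: param_rel_def topspace_param)
    then show ?thesis
      using key[OF st(3) _ _ st(4,5)] by (auto simp: Nica_p_def)
  qed simp
  fix s t assume "(s, t) \<in> param_rel"
  moreover from this have "(t, s) \<in> param_rel"
    using equiv_param_rel by (meson equivE symD)
  ultimately show "Nica_p s = Nica_p t"
    using sub by blast
qed

lemma Nica_p_tilde_class:
  assumes "s \<in> topspace param_topology"
  shows "Nica_p_tilde (param_rel `` {s}) = Nica_p s"
proof -
  have "s \<in> param_rel `` {s}"
    using assms equiv_param_rel by (rule equiv_class_self[rotated])
  moreover have "Nica_p t = Nica_p s" if "t \<in> param_rel `` {s}" for t
    using that Nica_p_respects by (auto simp: congruent_def)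
  ultimately have "Nica_p ` (param_rel `` {s}) = {Nica_p s}" by blast
  then show ?thesis by (simp add: Nica_p_tilde_def)
qed

end

(*
  The parameter space is compact, the Nica spectrum is Hausdorff and p is continuous, so it suffices
  that the induced map is a continuous bijection. The image of p is compact, hence closed, and it
  contains the principal sets {x. x <= (n, k)} = p(n, k), which are dense because a directed set
  contains an upper bound of any finite part of it. For injectivity, a profinite integer is
  determined up to a unit by the prime powers that divide it, so p(r, a) determines a; then r is
  read off as the largest m with (m, 1) in p(r, a), or, for r of type B, modulo each prime power
  dividing a, which gives r modulo a.
*)

theory Submission
  imports Defs "HOL-Number_Theory.Cong"
begin

section \<open>Divisibility of profinite integers\<close>

text \<open>The common currency is the set of pairs (p, n) with \<open>x p n = 0\<close>, that is,
  with p^n dividing x: ideal membership, unit orbits and cosets of k Zhat all become statements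
  about vanishing or prescribed coordinates. Behind this stands the fact that Zp is a valuation
  ring, proved on residue sequences: dividing by x loses as many levels of precision as x has
  factors p, so quotients are computed at a shifted level. Two consequences drive the rest. For k >
  0 a condition modulo k tests only finitely many nontrivial coordinates, so membership of one (m,
  k) in p(r, a) is a clopen condition on (r, a). And arbitrarily large naturals approximate a
  profinite integer modulo k, which supplies the upper bounds in type B. The tails n >= n0 in the
  topology of the disjoint union match the order condition m <= n of type A, which has no
  counterpart in type B.\<close>

lemma Zp_reduce:
  assumes "x \<in> carrier (Zp p)" "n \<le> m"
  shows "x m mod int p ^ n = x n"
  using assms(2)
proof (induction m rule: dec_induct)
  case base
  then show ?case using assms(1) by (simp add: Zp_def)
next
  case (step m)
  have "x (Suc m) mod int p ^ n = x (Suc m) mod int p ^ m mod int p ^ n"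
    using step.hyps by (simp add: mod_mod_cancel le_imp_power_dvd)
  also have "\<dots> = x n"
    using assms(1) step.IH by (simp add: Zp_def)
  finally show ?case .
qed

lemma Zp_eq_0_iff:
  assumes "x \<in> carrier (Zp p)" "n \<le> m"
  shows "x n = 0 \<longleftrightarrow> int p ^ n dvd x m"
  using Zp_reduce[OF assms] by (simp add: dvd_eq_mod_eq_0)

text \<open>This v is the p-adic valuation of x. The search can start at 0 because the only residue
  modulo p^0 = 1 is 0.\<close>

lemma Zp_first_nonzero:
  assumes "x \<in> carrier (Zp p)" "x n \<noteq> 0"
  shows "\<exists>v. x v = 0 \<and> x (Suc v) \<noteq> 0"
proof -
  have "x 0 = 0"
    using assms(1) by (auto simp: Zp_def dest!: spec[of _ 0])
  then show ?thesis
    using ex_least_nat_less[of "\<lambda>n. x n \<noteq> 0" n] assms(2) by auto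
qed

text \<open>Since x has valuation at most v, cancelling it costs at most v levels: if p^(n+v)
  divides x (c - d), then x absorbs at most v of the factors p and at least n of them divide c -
  d.\<close>

lemma Zp_cancel:
  assumes p: "prime p" and x: "x \<in> carrier (Zp p)" "x (Suc v) \<noteq> 0"
    and c: "[x (n + v) * c = x (n + v) * d] (mod int p ^ (n + v))"
  shows "[c = d] (mod int p ^ n)"
\<comment> \<open>For n > 0 the level n + v is at least Suc v, so divisibility by p^(Suc v) can be
  tested on \<open>x (n + v)\<close>.\<close>
proof (cases "n = 0")
  case False
  have "int p ^ (n + v) dvd x (n + v) * (c - d)"
    using c by (simp add: cong_iff_dvd_diff right_diff_distrib)
  then obtain a b where ab: "a + b = n + v" "int p ^ a dvd x (n + v)" "int p ^ b dvd c - d"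
    using prime_elem_power_dvd_prod[of "int p" "n + v" "x (n + v)" "c - d"] p by auto
  have "\<not> int p ^ Suc v dvd x (n + v)"
    using Zp_eq_0_iff[OF x(1), of "Suc v" "n + v"] x(2) False by simp
  then have "\<not> Suc v \<le> a"
    using ab(2) by (meson dvd_trans le_imp_power_dvd)
  then have "n \<le> b"
    using ab(1) by simp
  then show ?thesis
    using ab(3) by (meson cong_iff_dvd_diff dvd_trans le_imp_power_dvd)
qed simp

text \<open>A linear congruence is solvable once the gcd of coefficient and modulus divides the
  right-hand side. Here the gcd is p^j with j at most v, while \<open>y v = 0\<close> says that p^v
  divides y.\<close>

lemma Zp_solve:
  assumes p: "prime p" and x: "x \<in> carrier (Zp p)" "x (Suc v) \<noteq> 0"
    and y: "y \<in> carrier (Zp p)" "y v = 0"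
  shows "\<exists>c. [x (n + v) * c = y (n + v)] (mod int p ^ (n + v))"
proof -
  define g where "g = gcd (x (n + v)) (int p ^ (n + v))"
  obtain j where j: "j \<le> n + v" "normalize g = int p ^ j"
    using divides_primepow[of "int p" g "n + v"] p by (auto simp: g_def)
  then have g: "g = int p ^ j"
    by (simp add: g_def)
  have "j \<le> v"
  proof (rule ccontr)
    assume "\<not> j \<le> v"
    then have "int p ^ Suc v dvd g"
      unfolding g by (intro le_imp_power_dvd) simp
    then have "int p ^ Suc v dvd x (n + v)"
      by (simp add: g_def)
    then show False
      using Zp_eq_0_iff[OF x(1), of "Suc v" "n + v"] x(2) j(1) \<open>\<not> j \<le> v\<close> by simp
  qed
  then have "g dvd y (n + v)"
    using Zp_eq_0_iff[OF y(1), of v "n + v"] y(2) unfolding g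
    by (meson dvd_trans le_add2 le_imp_power_dvd)
  then obtain b where b: "y (n + v) = g * b" ..
  obtain s t where "s * x (n + v) + t * int p ^ (n + v) = g"
    using bezout_int unfolding g_def by metis
  then have "x (n + v) * (s * b) - y (n + v) = int p ^ (n + v) * (- t * b)"
    unfolding b by (auto simp: algebra_simps)
  then show ?thesis
    by (metis cong_iff_dvd_diff dvd_triv_left)
qed

text \<open>The hypothesis compares valuations. The low coordinates of x vanish, so the quotient
  cannot be found level by level; its n-th coordinate is solved for at level n + v, where the
  solution is unique modulo p^n.\<close>

lemma Zp_dvd:
  assumes p: "prime p" and x: "x \<in> carrier (Zp p)" and y: "y \<in> carrier (Zp p)"
    and vanish: "\<And>n. x n = 0 \<Longrightarrow> y n = 0"
  shows "\<exists>w\<in>carrier (Zp p). y = w \<otimes>\<^bsub>Zp p\<^esub> x"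
proof (cases "\<forall>n. x n = 0")
  case True
  then have "y = \<zero>\<^bsub>Zp p\<^esub> \<otimes>\<^bsub>Zp p\<^esub> x"
    using vanish by (auto simp: Zp_def)
  moreover have "\<zero>\<^bsub>Zp p\<^esub> \<in> carrier (Zp p)"
    using p by (simp add: Zp_def prime_gt_0_nat)
  ultimately show ?thesis by blast
next
  case False
  then obtain v where v: "x v = 0" "x (Suc v) \<noteq> 0"
    using Zp_first_nonzero[OF x] by auto
  note xv = v(2) vanish[OF v(1)]
  define c where "c n = (SOME c. [x (n + v) * c = y (n + v)] (mod int p ^ (n + v)))" for n
  have c: "[x (n + v) * c n = y (n + v)] (mod int p ^ (n + v))" for n
    unfolding c_def using Zp_solve[OF p x xv(1) y xv(2)] by (rule someI_ex)
  have red: "[z m = z n] (mod int p ^ n)" if "z \<in> carrier (Zp p)" "n \<le> m" for z m n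
    using Zp_reduce[OF that] Zp_reduce[OF that(1) order_refl, of n] by (simp add: cong_def)
  define w where "w n = c n mod int p ^ n" for n
  have "w \<in> carrier (Zp p)"
  proof -
    \<comment> \<open>Reduced modulo p^(n+v), the congruence defining \<open>c (Suc n)\<close>
      becomes the one defining \<open>c n\<close>; cancelling x makes the arbitrary choices
      coherent.\<close>
    have "c (Suc n) mod int p ^ n = c n mod int p ^ n" for n
    proof -
      have "[x (Suc n + v) * c (Suc n) = y (Suc n + v)] (mod int p ^ (n + v))"
        using c[of "Suc n"] by (rule cong_dvd_modulus) (simp add: le_imp_power_dvd)
      moreover have "[x (Suc n + v) * c (Suc n) = x (n + v) * c (Suc n)] (mod int p ^ (n + v))"
        by (intro cong_mult cong_refl red x) simp
      moreover have "[y (Suc n + v) = y (n + v)] (mod int p ^ (n + v))"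
        by (intro red y) simp
      ultimately have "[x (n + v) * c (Suc n) = x (n + v) * c n] (mod int p ^ (n + v))"
        using c[of n] unfolding cong_def by argo
      then have "[c (Suc n) = c n] (mod int p ^ n)"
        by (rule Zp_cancel[OF p x xv(1)])
      then show ?thesis
        by (simp add: cong_def)
    qed
    then show ?thesis
      using p by (simp add: Zp_def w_def prime_gt_0_nat mod_power_Suc_mod del: power_Suc)
  qed
  moreover have "y n = w n * x n mod int p ^ n" for n
  proof -
    have "[x (n + v) * c n = y (n + v)] (mod int p ^ n)"
      using c[of n] by (rule cong_dvd_modulus) (simp add: le_imp_power_dvd)
    moreover have "[x (n + v) * c n = x n * w n] (mod int p ^ n)"
      by (intro cong_mult red x) (simp_all add: w_def cong_def)
    moreover have "[y (n + v) = y n] (mod int p ^ n)"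
      by (intro red y) simp
    ultimately have "y n mod int p ^ n = x n * w n mod int p ^ n"
      unfolding cong_def by argo
    then show ?thesis
      unfolding Zp_reduce[OF y order_refl] by (simp only: mult.commute)
  qed
  ultimately show ?thesis
    by (intro bexI[of _ w]) (auto simp: Zp_def)
qed

text \<open>Each of x and y divides the other, so x = e x with e = w' w. If x is nonzero, cancelling
  it at level n + v gives e = 1 modulo p^n for every n, and w is a unit; if x is zero, so is
  y.\<close>

lemma Zp_associated:
  assumes p: "prime p" and x: "x \<in> carrier (Zp p)" and y: "y \<in> carrier (Zp p)"
    and vanish: "\<And>n. x n = 0 \<longleftrightarrow> y n = 0"
  shows "\<exists>u\<in>Units (Zp p). y = u \<otimes>\<^bsub>Zp p\<^esub> x"
proof -
  interpret cring "Zp p" using p by (intro cring_Zp prime_gt_0_nat)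
  obtain w w' where w: "w \<in> carrier (Zp p)" "y = w \<otimes>\<^bsub>Zp p\<^esub> x"
    and w': "w' \<in> carrier (Zp p)" "x = w' \<otimes>\<^bsub>Zp p\<^esub> y"
    using Zp_dvd[OF p x y] Zp_dvd[OF p y x] vanish by metis
  show ?thesis
  proof (cases "\<forall>n. x n = 0")
    case True
    then have "x = \<zero>\<^bsub>Zp p\<^esub>" "y = \<zero>\<^bsub>Zp p\<^esub>"
      using vanish by (auto simp: Zp_def)
    then show ?thesis
      by (intro bexI[of _ "\<one>\<^bsub>Zp p\<^esub>"]) auto
  next
    case False
    then obtain v where v: "x (Suc v) \<noteq> 0"
      using Zp_first_nonzero[OF x] by auto
    define e where "e = w' \<otimes>\<^bsub>Zp p\<^esub> w"
    have e: "e \<in> carrier (Zp p)" "x = e \<otimes>\<^bsub>Zp p\<^esub> x"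
      using w w' x m_assoc by (auto simp: e_def)
    have "e n = 1 mod int p ^ n" for n
    proof -
      have "x (n + v) = e (n + v) * x (n + v) mod int p ^ (n + v)"
        using arg_cong[OF e(2), of "\<lambda>f. f (n + v)"] by (simp add: Zp_def)
      then have "[x (n + v) * e (n + v) = x (n + v) * 1] (mod int p ^ (n + v))"
        unfolding cong_def by (metis mod_mod_trivial mult.commute mult.right_neutral)
      then have "[e (n + v) = 1] (mod int p ^ n)"
        by (rule Zp_cancel[OF p x v])
      then show ?thesis
        using Zp_reduce[OF e(1), of n "n + v"] by (simp add: cong_def)
    qed
    then have "e = \<one>\<^bsub>Zp p\<^esub>"
      by (auto simp: Zp_def)
    then have "w \<in> Units (Zp p)"
      using w(1) w'(1) m_comm by (auto simp: Units_def e_def)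
    then show ?thesis
      using w(2) by blast
  qed
qed

section \<open>Principal ideals and unit orbits of Zhat through coordinates\<close>

lemma Zhat_component [simp]:
  "x \<in> carrier Zhat \<Longrightarrow> prime p \<Longrightarrow> x p \<in> carrier (Zp p)"
  by (auto simp: Zhat_def)

lemma Zhat_mult_component:
  "prime p \<Longrightarrow> (x \<otimes>\<^bsub>Zhat\<^esub> y) p n = x p n * y p n mod int p ^ n"
  by (simp add: Zhat_def Zp_def)

text \<open>Negation in \<open>Zhat\<close> is available only as an abstract inverse, so the
  coordinates of the difference d are obtained by solving x = d + y.\<close>

lemma Zhat_minus_component:
  assumes "x \<in> carrier Zhat" "y \<in> carrier Zhat" "prime p"
  shows "(x \<ominus>\<^bsub>Zhat\<^esub> y) p n = (x p n - y p n) mod int p ^ n"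
proof -
  interpret cring Zhat by (rule cring_Zhat)
  define d where "d = x \<ominus>\<^bsub>Zhat\<^esub> y"
  have d: "d \<in> carrier Zhat"
    unfolding d_def using assms(1,2) by (rule minus_closed)
  have "x = d \<oplus>\<^bsub>Zhat\<^esub> y"
    using assms(1,2) by (simp add: d_def a_minus_def a_assoc l_neg)
  from arg_cong[OF this, of "\<lambda>f. f p n"] have "x p n = (d p n + y p n) mod int p ^ n"
    using assms(3) by (simp add: Zhat_def Zp_def)
  then have "(x p n - y p n) mod int p ^ n = ((d p n + y p n) mod int p ^ n - y p n) mod int p ^ n"
    by (rule arg_cong)
  also have "\<dots> = d p n mod int p ^ n"
    by (simp add: mod_diff_left_eq)
  also have "\<dots> = d p n"
    using Zp_reduce[OF Zhat_component[OF d assms(3)] order_refl] .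
  finally show ?thesis by (simp add: d_def)
qed

lemma diag_component: "prime p \<Longrightarrow> diag k p n = int k mod int p ^ n"
  by (simp add: diag_def)

text \<open>Cofactors can be chosen independently at each prime, so divisibility in the product is
  divisibility in every factor, where it is a comparison of valuations.\<close>

lemma mem_PIdl_iff:
  assumes x: "x \<in> carrier Zhat" and y: "y \<in> carrier Zhat"
  shows "y \<in> PIdl\<^bsub>Zhat\<^esub> x \<longleftrightarrow> (\<forall>p n. prime p \<longrightarrow> x p n = 0 \<longrightarrow> y p n = 0)"
proof
  assume "y \<in> PIdl\<^bsub>Zhat\<^esub> x"
  then show "\<forall>p n. prime p \<longrightarrow> x p n = 0 \<longrightarrow> y p n = 0"
    by (auto simp: cgenideal_def Zhat_mult_component)
next
  assume R: "\<forall>p n. prime p \<longrightarrow> x p n = 0 \<longrightarrow> y p n = 0"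
  have "\<exists>w\<in>carrier (Zp p). y p = w \<otimes>\<^bsub>Zp p\<^esub> x p" if "prime p" for p
    using Zp_dvd[of p "x p" "y p"] that R x y by simp
  then obtain w where w: "\<And>p. prime p \<Longrightarrow> w p \<in> carrier (Zp p) \<and> y p = w p \<otimes>\<^bsub>Zp p\<^esub> x p"
    by metis
  define z where "z = restrict w {p. prime p}"
  have "z \<in> carrier Zhat"
    using w by (auto simp: Zhat_def z_def)
  moreover have "y = z \<otimes>\<^bsub>Zhat\<^esub> x"
    using w y by (auto simp: Zhat_def z_def PiE_def extensional_def)
  ultimately show "y \<in> PIdl\<^bsub>Zhat\<^esub> x"
    by (auto simp: cgenideal_def)
qed

text \<open>The vanishing pattern records the valuation of x at each prime, infinity allowed, so
  orbits are supernatural numbers. Elements of one orbit divide each other; conversely, local units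
  assemble to a unit of the product.\<close>

lemma unit_orbit_eq_iff:
  assumes x: "x \<in> carrier Zhat" and y: "y \<in> carrier Zhat"
  shows "unit_orbit x = unit_orbit y \<longleftrightarrow> (\<forall>p n. prime p \<longrightarrow> (x p n = 0 \<longleftrightarrow> y p n = 0))"
proof
  have mem: "b \<in> PIdl\<^bsub>Zhat\<^esub> a" if "unit_orbit a = unit_orbit b" "b \<in> carrier Zhat" for a b
  proof -
    interpret cring Zhat by (rule cring_Zhat)
    have "b \<in> unit_orbit a"
      using that unit_orbit_self by simp
    then show ?thesis
      by (auto simp: unit_orbit_def Group_Action.orbit_def units_of_def cgenideal_def Units_closed)
  qed
  assume "unit_orbit x = unit_orbit y"
  then show "\<forall>p n. prime p \<longrightarrow> (x p n = 0 \<longleftrightarrow> y p n = 0)"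
    using mem[of x y] mem[of y x] mem_PIdl_iff x y by blast
next
  interpret cring Zhat by (rule cring_Zhat)
  assume R: "\<forall>p n. prime p \<longrightarrow> (x p n = 0 \<longleftrightarrow> y p n = 0)"
  have "\<exists>u\<in>Units (Zp p). y p = u \<otimes>\<^bsub>Zp p\<^esub> x p" if "prime p" for p
    using Zp_associated[of p "x p" "y p"] that R x y by simp
  \<comment> \<open>The inverses are chosen together with the units, because the assembled element
    needs an inverse in the product as well.\<close>
  then have "\<exists>u u'. u \<in> carrier (Zp p) \<and> u' \<in> carrier (Zp p) \<and> u' \<otimes>\<^bsub>Zp p\<^esub> u = \<one>\<^bsub>Zp p\<^esub> \<and>
      u \<otimes>\<^bsub>Zp p\<^esub> u' = \<one>\<^bsub>Zp p\<^esub> \<and> y p = u \<otimes>\<^bsub>Zp p\<^esub> x p" if "prime p" for p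
    using that unfolding Units_def by blast
  then obtain u u' where u: "\<And>p. prime p \<Longrightarrow> u p \<in> carrier (Zp p) \<and> u' p \<in> carrier (Zp p) \<and>
      u' p \<otimes>\<^bsub>Zp p\<^esub> u p = \<one>\<^bsub>Zp p\<^esub> \<and> u p \<otimes>\<^bsub>Zp p\<^esub> u' p = \<one>\<^bsub>Zp p\<^esub> \<and> y p = u p \<otimes>\<^bsub>Zp p\<^esub> x p"
    by metis
  define z z' where "z = restrict u {p. prime p}" and "z' = restrict u' {p. prime p}"
  have zc: "z \<in> carrier Zhat" "z' \<in> carrier Zhat"
    using u by (auto simp: Zhat_def z_def z'_def)
  have "z' \<otimes>\<^bsub>Zhat\<^esub> z = \<one>\<^bsub>Zhat\<^esub>" "z \<otimes>\<^bsub>Zhat\<^esub> z' = \<one>\<^bsub>Zhat\<^esub>"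
    using u by (auto simp: Zhat_def z_def z'_def intro!: restrict_ext)
  then have z: "z \<in> Units Zhat"
    using zc by (auto simp: Units_def)
  have yz: "y = z \<otimes>\<^bsub>Zhat\<^esub> x"
    using u y by (auto simp: Zhat_def z_def PiE_def extensional_def)
  have orbit: "unit_orbit a = (\<lambda>v. v \<otimes>\<^bsub>Zhat\<^esub> a) ` Units Zhat" for a
    by (auto simp: unit_orbit_def Group_Action.orbit_def units_of_def)
  have yx: "v \<otimes>\<^bsub>Zhat\<^esub> y \<in> unit_orbit x" if "v \<in> Units Zhat" for v
    unfolding orbit yz using that z x
    by (intro image_eqI[of _ _ "v \<otimes>\<^bsub>Zhat\<^esub> z"]) (auto simp: m_assoc Units_closed)
  have xy: "v \<otimes>\<^bsub>Zhat\<^esub> x \<in> unit_orbit y" if "v \<in> Units Zhat" for v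
    unfolding orbit using that z x
    by (intro image_eqI[of _ _ "v \<otimes>\<^bsub>Zhat\<^esub> inv\<^bsub>Zhat\<^esub> z"])
      (auto simp: yz m_assoc Units_closed Units_l_inv simp flip: m_assoc[of "inv\<^bsub>Zhat\<^esub> z"])
  show "unit_orbit x = unit_orbit y"
  proof
    show "unit_orbit x \<subseteq> unit_orbit y"
      unfolding orbit[of x] by (rule image_subsetI) (rule xy)
    show "unit_orbit y \<subseteq> unit_orbit x"
      unfolding orbit[of y] by (rule image_subsetI) (rule yx)
  qed
qed

lemma mem_PIdl_diag_iff:
  assumes "x \<in> carrier Zhat"
  shows "x \<in> PIdl\<^bsub>Zhat\<^esub> (diag k) \<longleftrightarrow> (\<forall>p n. prime p \<longrightarrow> p ^ n dvd k \<longrightarrow> x p n = 0)"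
proof -
  have "diag k p n = 0 \<longleftrightarrow> p ^ n dvd k" if "prime p" for p n
    using that by (simp add: diag_component flip: of_nat_power of_nat_mod dvd_eq_mod_eq_0)
  then show ?thesis
    using assms by (auto simp: mem_PIdl_iff)
qed

text \<open>Membership in k Zhat depends only on vanishing coordinates, hence is constant on orbits;
  from here on the condition on a can be checked on any representative.\<close>

lemma unit_orbit_mem_PIdl_iff:
  assumes x: "x \<in> carrier Zhat"
  shows "unit_orbit x \<in> unit_orbit ` (PIdl\<^bsub>Zhat\<^esub> (diag k)) \<longleftrightarrow> x \<in> PIdl\<^bsub>Zhat\<^esub> (diag k)"
proof
  interpret cring Zhat by (rule cring_Zhat)
  assume "unit_orbit x \<in> unit_orbit ` (PIdl\<^bsub>Zhat\<^esub> (diag k))"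
  then obtain y where y: "y \<in> PIdl\<^bsub>Zhat\<^esub> (diag k)" "unit_orbit x = unit_orbit y"
    by blast
  then have "y \<in> carrier Zhat"
    using ideal.Icarr[OF cgenideal_ideal] diag_closed by blast
  then show "x \<in> PIdl\<^bsub>Zhat\<^esub> (diag k)"
    using y x by (simp add: mem_PIdl_diag_iff unit_orbit_eq_iff)
qed simp

lemma minus_diag_mem_PIdl_iff:
  assumes "z \<in> carrier Zhat"
  shows "z \<ominus>\<^bsub>Zhat\<^esub> diag m \<in> PIdl\<^bsub>Zhat\<^esub> (diag k) \<longleftrightarrow>
    (\<forall>p n. prime p \<longrightarrow> p ^ n dvd k \<longrightarrow> z p n = int m mod int p ^ n)"
proof -
  interpret cring Zhat by (rule cring_Zhat)
  have "(z \<ominus>\<^bsub>Zhat\<^esub> diag m) p n = 0 \<longleftrightarrow> z p n = int m mod int p ^ n" if "prime p" for p n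
  proof -
    have "(z p n - int m mod int p ^ n) mod int p ^ n = 0 \<longleftrightarrow>
        z p n mod int p ^ n = int m mod int p ^ n mod int p ^ n"
      by (simp only: mod_eq_dvd_iff dvd_eq_mod_eq_0)
    then show ?thesis
      using that assms Zp_reduce[OF Zhat_component[OF assms that] order_refl, of n]
      by (simp add: Zhat_minus_component diag_component)
  qed
  then show ?thesis
    using assms by (simp add: mem_PIdl_diag_iff)
qed

section \<open>Natural numbers among the profinite integers\<close>

lemma dvd_iff_prime_powers:
  fixes a b :: nat
  assumes "b > 0"
  shows "b dvd a \<longleftrightarrow> (\<forall>p n. prime p \<longrightarrow> p ^ n dvd b \<longrightarrow> p ^ n dvd a)"
proof
  assume R: "\<forall>p n. prime p \<longrightarrow> p ^ n dvd b \<longrightarrow> p ^ n dvd a"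
  show "b dvd a"
  proof (cases "a = 0")
    case False
    then have "multiplicity p b \<le> multiplicity p a" if "prime p" for p
      using R that by (intro multiplicity_geI) (auto simp: multiplicity_dvd dest: not_prime_unit)
    then show ?thesis
      using assms False by (intro multiplicity_le_imp_dvd) auto
  qed simp
qed (auto intro: dvd_trans)

text \<open>An integer lying in k Zhat is a multiple of k. Hence on naturals the type A and type B
  conditions differ only by the requirement m <= n.\<close>

lemma diag_minus_diag_mem_PIdl_iff:
  assumes "k > 0"
  shows "diag n \<ominus>\<^bsub>Zhat\<^esub> diag m \<in> PIdl\<^bsub>Zhat\<^esub> (diag k) \<longleftrightarrow> int k dvd int n - int m"
proof -
  have "diag n \<ominus>\<^bsub>Zhat\<^esub> diag m \<in> PIdl\<^bsub>Zhat\<^esub> (diag k) \<longleftrightarrow>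
      (\<forall>p i. prime p \<longrightarrow> p ^ i dvd k \<longrightarrow> int (p ^ i) dvd int n - int m)"
    by (simp add: minus_diag_mem_PIdl_iff diag_component mod_eq_dvd_iff)
  also have "\<dots> \<longleftrightarrow> (\<forall>p i. prime p \<longrightarrow> p ^ i dvd k \<longrightarrow> p ^ i dvd nat \<bar>int n - int m\<bar>)"
    by (simp add: dvd_nat_abs_iff)
  also have "\<dots> \<longleftrightarrow> int k dvd int n - int m"
    using dvd_iff_prime_powers[OF assms, of "nat \<bar>int n - int m\<bar>"]
    by (simp add: dvd_nat_abs_iff)
  finally show ?thesis .
qed

lemma diag_mem_PIdl_diag_iff:
  assumes "k > 0"
  shows "diag l \<in> PIdl\<^bsub>Zhat\<^esub> (diag k) \<longleftrightarrow> k dvd l"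
  using dvd_iff_prime_powers[OF assms, of l]
  by (simp add: mem_PIdl_diag_iff diag_component flip: of_nat_power of_nat_mod dvd_eq_mod_eq_0)

lemma prime_power_dvd_lcm:
  fixes k l :: nat
  assumes "prime p" "p ^ n dvd lcm k l" "k > 0" "l > 0"
  shows "p ^ n dvd k \<or> p ^ n dvd l"
proof -
  have "n \<le> max (multiplicity p k) (multiplicity p l)"
    using assms power_dvd_iff_le_multiplicity[of "lcm k l" p n] prime_gt_1_nat[of p]
    by (simp add: multiplicity_lcm lcm_pos_nat)
  then show ?thesis
    by (metis le_max_iff_disj multiplicity_dvd')
qed

text \<open>Density of the naturals, with control of size. The Chinese remainder theorem matches z
  modulo the exact power of each prime in k, and adding \<open>m0 * k\<close> makes the result large
  without changing its residues.\<close>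

lemma ex_nat_approx:
  assumes z: "z \<in> carrier Zhat" and k: "k > 0"
  shows "\<exists>m\<ge>m0. z \<ominus>\<^bsub>Zhat\<^esub> diag m \<in> PIdl\<^bsub>Zhat\<^esub> (diag k)"
proof -
  define e where "e p = multiplicity p k" for p
  have "\<forall>p\<in>prime_factors k. \<forall>q\<in>prime_factors k. p \<noteq> q \<longrightarrow> coprime (p ^ e p) (q ^ e q)"
    by (auto simp: in_prime_factors_iff intro: primes_coprime)
  then obtain r where r: "\<And>p. p \<in> prime_factors k \<Longrightarrow> [r = nat (z p (e p))] (mod p ^ e p)"
    using chinese_remainder_nat[of "prime_factors k" "\<lambda>p. p ^ e p" "\<lambda>p. nat (z p (e p))"]
    by blast
  have "z p n = int (r + m0 * k) mod int p ^ n" if p: "prime p" and n: "p ^ n dvd k" for p n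
  proof (cases "n = 0")
    case True
    then show ?thesis
      using Zp_reduce[OF Zhat_component[OF z p], of 0 0] by simp
  next
    case False
    have zp: "z p \<in> carrier (Zp p)" using z p by simp
    have "p dvd k"
      using n False by (meson dvd_power dvd_trans neq0_conv)
    then have "p \<in> prime_factors k"
      using p k by (simp add: in_prime_factors_iff)
    then have "[int r = int (nat (z p (e p)))] (mod int (p ^ e p))"
      using r cong_int_iff by blast
    moreover have "z p (e p) \<ge> 0"
      using zp by (simp add: Zp_def)
    ultimately have r': "[int r = z p (e p)] (mod int p ^ e p)"
      by simp
    have ne: "n \<le> e p"
      unfolding e_def using n k p by (intro multiplicity_geI) (auto dest: not_prime_unit)
    have "[int r = z p (e p)] (mod int p ^ n)"
      using r' by (rule cong_dvd_modulus) (simp add: ne le_imp_power_dvd)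
    moreover have "int p ^ n dvd int (m0 * k)"
      using n by (simp flip: of_nat_power)
    then have "[int (r + m0 * k) = int r] (mod int p ^ n)"
      by (simp add: cong_iff_dvd_diff)
    ultimately have "int (r + m0 * k) mod int p ^ n = z p (e p) mod int p ^ n"
      by (metis cong_def)
    then show ?thesis
      using Zp_reduce[OF zp ne] by simp
  qed
  then have "z \<ominus>\<^bsub>Zhat\<^esub> diag (r + m0 * k) \<in> PIdl\<^bsub>Zhat\<^esub> (diag k)"
    using z by (simp add: minus_diag_mem_PIdl_iff)
  moreover have "m0 \<le> r + m0 * k"
    using k by (simp add: trans_le_add2)
  ultimately show ?thesis by blast
qed

section \<open>Compactness and clopen sets\<close>

lemma clopen_vimage_discrete:
  assumes "continuous_map X (discrete_topology UNIV) f"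
  shows "openin X {x \<in> topspace X. f x \<in> S} \<and> closedin X {x \<in> topspace X. f x \<in> S}"
  using openin_continuous_map_preimage[OF assms, of S] closedin_continuous_map_preimage[OF assms, of S]
  by simp

lemma clopen_imp_continuous_map_discrete:
  assumes "openin X {x \<in> topspace X. P x}" "closedin X {x \<in> topspace X. P x}"
  shows "continuous_map X (discrete_topology (UNIV :: bool set)) P"
proof -
  have not: "openin X {x \<in> topspace X. \<not> P x}"
  proof -
    have "{x \<in> topspace X. \<not> P x} = topspace X - {x \<in> topspace X. P x}" by blast
    then show ?thesis using assms(2) by (simp add: closedin_def)
  qed
  have "openin X {x \<in> topspace X. P x \<in> U}" for U
  proof -
    have "U = {} \<or> U = {True} \<or> U = {False} \<or> U = UNIV"
      by (cases "True \<in> U"; cases "False \<in> U") (auto simp: UNIV_bool, (metis (full_types))+)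
    then show ?thesis
      using assms(1) not by auto
  qed
  then show ?thesis
    by (simp add: continuous_map_def)
qed

lemma clopen_Ball:
  assumes "finite F"
    and "\<And>i. i \<in> F \<Longrightarrow> openin X {x \<in> topspace X. P i x} \<and> closedin X {x \<in> topspace X. P i x}"
  shows "openin X {x \<in> topspace X. \<forall>i\<in>F. P i x} \<and> closedin X {x \<in> topspace X. \<forall>i\<in>F. P i x}"
  using assms
proof (induction F rule: finite_induct)
  case (insert i F)
  have "{x \<in> topspace X. \<forall>i\<in>insert i F. P i x} =
      {x \<in> topspace X. P i x} \<inter> {x \<in> topspace X. \<forall>i\<in>F. P i x}"
    by blast
  then show ?case
    using insert.IH insert.prems by (simp add: openin_Int closedin_Int)
qed simp

text \<open>By Tychonoff the product of the finite residue sets is compact, and the coherence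
  conditions cut out a closed subset.\<close>

lemma compact_space_Zp: "compact_space (Zp_topology p)"
proof -
  let ?X = "product_topology (\<lambda>_::nat. discrete_topology (UNIV :: int set)) UNIV"
  have proj: "continuous_map ?X (discrete_topology UNIV) (\<lambda>x. x n)" for n
    using continuous_map_product_projection[of n UNIV "\<lambda>_. discrete_topology UNIV"] by simp
  have "closedin ?X {x \<in> topspace ?X. x (Suc n) mod int p ^ n = x n}" for n
  proof -
    have "closedin ?X {x \<in> topspace ?X. x n = c \<and> x (Suc n) mod int p ^ n = c}" for c
    proof -
      have "{x \<in> topspace ?X. x n = c \<and> x (Suc n) mod int p ^ n = c} =
          {x \<in> topspace ?X. x n \<in> {c}} \<inter> {x \<in> topspace ?X. x (Suc n) \<in> {a. a mod int p ^ n = c}}"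
        by blast
      then show ?thesis
        using clopen_vimage_discrete[OF proj] by (simp only: closedin_Int)
    qed
    \<comment> \<open>Coherence compares two coordinates. Fixing the value c of one of them turns
      its failure into conditions on single coordinates, and the union over c is still open.\<close>
    have "openin ?X {x \<in> topspace ?X. x n = c \<and> x (Suc n) mod int p ^ n \<noteq> c}" for c
    proof -
      have "{x \<in> topspace ?X. x n = c \<and> x (Suc n) mod int p ^ n \<noteq> c} =
          {x \<in> topspace ?X. x n \<in> {c}} \<inter> {x \<in> topspace ?X. x (Suc n) \<in> {a. a mod int p ^ n \<noteq> c}}"
        by blast
      then show ?thesis
        using clopen_vimage_discrete[OF proj] by (simp only: openin_Int)
    qed
    then have "openin ?X (\<Union>c. {x \<in> topspace ?X. x n = c \<and> x (Suc n) mod int p ^ n \<noteq> c})"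
      by blast
    moreover have "(\<Union>c. {x \<in> topspace ?X. x n = c \<and> x (Suc n) mod int p ^ n \<noteq> c}) =
        topspace ?X - {x \<in> topspace ?X. x (Suc n) mod int p ^ n = x n}"
      by auto
    ultimately show ?thesis
      unfolding closedin_def by auto
  qed
  then have C: "closedin ?X (\<Inter>n. {x \<in> topspace ?X. x (Suc n) mod int p ^ n = x n})"
    by blast
  have K: "compactin ?X (\<Pi>\<^sub>E n\<in>UNIV. {0..<int p ^ n})"
    by (simp add: compactin_PiE compactin_discrete_topology)
  have "carrier (Zp p) =
      (\<Pi>\<^sub>E n\<in>UNIV. {0..<int p ^ n}) \<inter> (\<Inter>n. {x \<in> topspace ?X. x (Suc n) mod int p ^ n = x n})"
    by (auto simp: Zp_def PiE_UNIV_domain)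
  then have "compactin ?X (carrier (Zp p))"
    using compact_Int_closedin[OF K C] by (simp only:)
  then show ?thesis
    unfolding Zp_topology_def by (rule compact_space_subtopology)
qed

lemma compact_space_Zhat: "compact_space Zhat_topology"
  by (simp add: Zhat_topology_def compact_space_product_topology compact_space_Zp)

lemma compact_space_quotient_topology:
  assumes "compact_space X"
  shows "compact_space (quotient_topology X f)"
  using image_compactin[OF _ quotient_imp_continuous_map[OF quotient_map_quotient_topology], of X "topspace X" f]
    assms by (simp add: compact_space_def)

text \<open>\<open>topology_generated_by\<close> treats the family as a subbase; the induction shows
  that it is already a neighbourhood base at points of type B. Intersections are handled by the
  larger threshold and the intersected open sets.\<close>

lemma Nbar_nhds_Inr:
  assumes "openin Nbar_topology W" "Inr z \<in> W"
  shows "\<exists>n0 U. openin Zhat_topology U \<and> z \<in> U \<and> Inl ` {n. n \<ge> n0 \<and> diag n \<in> U} \<union> Inr ` U \<subseteq> W"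
proof -
  have "generate_topology_on (range (\<lambda>n. {Inl n}) \<union>
      {Inl ` {n. n \<ge> n0 \<and> diag n \<in> U} \<union> Inr ` U | n0 U. openin Zhat_topology U}) W"
    using assms(1) unfolding Nbar_topology_def by (rule openin_topology_generated_by)
  then show ?thesis
    using assms(2)
  proof induction
    case (Int V W)
    obtain n U where U: "openin Zhat_topology U" "z \<in> U"
        "Inl ` {m. m \<ge> n \<and> diag m \<in> U} \<union> Inr ` U \<subseteq> V"
      using Int.IH(1) Int.prems by blast
    obtain n' U' where U': "openin Zhat_topology U'" "z \<in> U'"
        "Inl ` {m. m \<ge> n' \<and> diag m \<in> U'} \<union> Inr ` U' \<subseteq> W"
      using Int.IH(2) Int.prems by blast
    have "Inl ` {m. m \<ge> max n n' \<and> diag m \<in> U \<inter> U'} \<union> Inr ` (U \<inter> U') \<subseteq> V \<inter> W"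
      using U(3) U'(3) by auto
    then show ?case
      using U U' by (meson IntI openin_Int)
  next
    case (UN K)
    then obtain V where "V \<in> K" "Inr z \<in> V"
      by blast
    then show ?case
      using UN.IH by (meson Union_upper order_trans)
  next
    case (Basis V)
    then show ?case by blast
  qed simp
qed

text \<open>A basic neighbourhood of a profinite integer also contains all large naturals whose
  image lies in its open set. Finitely many such open sets cover Zhat, so all naturals from some
  \<open>N\<close> on are covered too, and finitely many points remain.\<close>

lemma compact_space_Nbar: "compact_space Nbar_topology"
  unfolding compact_space_alt
proof (intro allI impI, elim conjE)
  fix \<U> assume op: "\<forall>U\<in>\<U>. openin Nbar_topology U" and cover: "topspace Nbar_topology \<subseteq> \<Union>\<U>"
  define good where "good z W n U \<longleftrightarrow> W \<in> \<U> \<and> openin Zhat_topology U \<and> z \<in> U \<and>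
      Inl ` {m. m \<ge> n \<and> diag m \<in> U} \<union> Inr ` U \<subseteq> W" for z W n U
  have "\<exists>W n U. good z W n U" if z: "z \<in> carrier Zhat" for z
  proof -
    have "Inr z \<in> topspace Nbar_topology"
      using z by simp
    then obtain W where "W \<in> \<U>" "Inr z \<in> W"
      using cover by blast
    then show ?thesis
      unfolding good_def using Nbar_nhds_Inr[of W z] op by blast
  qed
  then obtain W n U where "\<And>z. z \<in> carrier Zhat \<Longrightarrow> good z (W z) (n z) (U z)"
    by metis
  note WU = this[unfolded good_def]
  have "\<exists>\<F>. finite \<F> \<and> \<F> \<subseteq> U ` carrier Zhat \<and> topspace Zhat_topology \<subseteq> \<Union>\<F>"
    using compact_space_Zhat WU unfolding compact_space_alt
    by (elim allE[of _ "U ` carrier Zhat"] impE) auto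
  then obtain F where F: "finite F" "F \<subseteq> carrier Zhat" "carrier Zhat \<subseteq> (\<Union>z\<in>F. U z)"
    by (metis finite_subset_image topspace_Zhat)
  \<comment> \<open>Inserting 0 keeps \<open>Max\<close> meaningful without an argument that
    \<open>F\<close> is nonempty.\<close>
  define N where "N = Max (insert 0 (n ` F))"
  have N: "n z \<le> N" if "z \<in> F" for z
    unfolding N_def using F(1) that by (intro Max_ge) auto
  have "Inl m \<in> topspace Nbar_topology" for m
    by simp
  then have "\<exists>V\<in>\<U>. Inl m \<in> V" for m
    using cover by blast
  then obtain V where V: "\<And>m. V m \<in> \<U> \<and> Inl m \<in> V m"
    by metis
  have "topspace Nbar_topology \<subseteq> \<Union>(W ` F \<union> V ` {..<N})"
  proof
    fix s assume s: "s \<in> topspace Nbar_topology"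
    show "s \<in> \<Union>(W ` F \<union> V ` {..<N})"
    proof (cases s)
      case (Inl m)
      show ?thesis
      proof (cases "m < N")
        case True
        then show ?thesis
          using V[of m] Inl by blast
      next
        case False
        obtain z where z: "z \<in> F" "diag m \<in> U z"
          using F(3) diag_closed by blast
        then have "m \<in> {m. m \<ge> n z \<and> diag m \<in> U z}" "z \<in> carrier Zhat"
          using F(2) N[of z] False by auto
        then have "Inl m \<in> W z"
          using WU[of z] by blast
        then show ?thesis
          using z(1) Inl by blast
      qed
    next
      case (Inr x)
      then obtain z where z: "z \<in> F" "x \<in> U z"
        using F(3) s by auto
      then have "Inr x \<in> W z"
        using WU[of z] F(2) by blast
      then show ?thesis
        using z(1) Inr by blast
    qed
  qed
  moreover have "W ` F \<union> V ` {..<N} \<subseteq> \<U>"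
    using WU V F(2) by blast
  moreover have "finite (W ` F \<union> V ` {..<N})"
    using F(1) by simp
  ultimately show "\<exists>\<F>. finite \<F> \<and> \<F> \<subseteq> \<U> \<and> topspace Nbar_topology \<subseteq> \<Union>\<F>"
    by (intro exI conjI)
qed

lemma compact_space_param: "compact_space param_topology"
  by (simp add: param_topology_def orbit_topology_def compact_space_prod_topology
      compact_space_Nbar compact_space_quotient_topology compact_space_Zhat)

section \<open>Clopen conditions modulo k\<close>

lemma continuous_map_Zhat_component:
  assumes "prime p"
  shows "continuous_map Zhat_topology (discrete_topology UNIV) (\<lambda>x. x p n)"
proof -
  have "continuous_map Zhat_topology (Zp_topology p) (\<lambda>x. x p)"
    using continuous_map_product_projection[of p "{p. prime p}" Zp_topology] assms
    by (simp add: Zhat_topology_def)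
  moreover have "continuous_map (Zp_topology p) (discrete_topology UNIV) (\<lambda>x. x n)"
    unfolding Zp_topology_def
    using continuous_map_product_projection[of n UNIV "\<lambda>_. discrete_topology UNIV"]
    by (intro continuous_map_from_subtopology) simp
  ultimately show ?thesis
    using continuous_map_compose by (fastforce simp: o_def)
qed

lemma clopen_diag_coset:
  assumes k: "k > 0"
  shows "openin Zhat_topology {z \<in> carrier Zhat. z \<ominus>\<^bsub>Zhat\<^esub> diag m \<in> PIdl\<^bsub>Zhat\<^esub> (diag k)} \<and>
    closedin Zhat_topology {z \<in> carrier Zhat. z \<ominus>\<^bsub>Zhat\<^esub> diag m \<in> PIdl\<^bsub>Zhat\<^esub> (diag k)}"
proof -
  \<comment> \<open>The condition n > 0 makes \<open>F\<close> finite: p^0 divides k for every prime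
    p, but the coordinate at 0 always vanishes and tests nothing.\<close>
  define F where "F = {(p, n). prime p \<and> p ^ n dvd k \<and> n > 0}"
  have "F \<subseteq> {..k} \<times> {..k}"
  proof (clarsimp simp: F_def)
    fix p n :: nat assume p: "prime p" and n: "p ^ n dvd k" "n > 0"
    have "n < p ^ n"
      using prime_gt_1_nat[OF p] by (simp add: power_gt_expt)
    moreover have "p \<le> p ^ n"
      using n prime_ge_1_nat[OF p] by (simp add: self_le_power)
    moreover have "p ^ n \<le> k"
      using n k by (simp add: dvd_imp_le)
    ultimately show "p \<le> k \<and> n \<le> k" by linarith
  qed
  then have fin: "finite F"
    by (rule finite_subset) simp
  have "z \<ominus>\<^bsub>Zhat\<^esub> diag m \<in> PIdl\<^bsub>Zhat\<^esub> (diag k) \<longleftrightarrow> (\<forall>i\<in>F. z (fst i) (snd i) = int m mod int (fst i) ^ snd i)"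
    if z: "z \<in> carrier Zhat" for z
  proof -
    have "z p 0 = 0" if "prime p" for p
      using Zp_reduce[OF Zhat_component[OF z that], of 0 0] by simp
    then have "(\<forall>p n. prime p \<longrightarrow> p ^ n dvd k \<longrightarrow> z p n = int m mod int p ^ n) \<longleftrightarrow>
        (\<forall>p n. prime p \<longrightarrow> p ^ n dvd k \<longrightarrow> n > 0 \<longrightarrow> z p n = int m mod int p ^ n)"
      by (metis gr0I mod_by_1 power_0)
    then show ?thesis
      unfolding minus_diag_mem_PIdl_iff[OF z] F_def by auto
  qed
  then have eq: "{z \<in> carrier Zhat. z \<ominus>\<^bsub>Zhat\<^esub> diag m \<in> PIdl\<^bsub>Zhat\<^esub> (diag k)} =
      {z \<in> topspace Zhat_topology. \<forall>i\<in>F. z (fst i) (snd i) = int m mod int (fst i) ^ snd i}"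
    by auto
  have clopen: "openin Zhat_topology {z \<in> topspace Zhat_topology. z (fst i) (snd i) = int m mod int (fst i) ^ snd i} \<and>
      closedin Zhat_topology {z \<in> topspace Zhat_topology. z (fst i) (snd i) = int m mod int (fst i) ^ snd i}"
    if "i \<in> F" for i
    using clopen_vimage_discrete[OF continuous_map_Zhat_component, of "fst i" "snd i" "{int m mod int (fst i) ^ snd i}"]
      that by (auto simp: F_def)
  show ?thesis
    unfolding eq using fin clopen by (rule clopen_Ball)
qed

lemma clopen_orbit_PIdl:
  fixes k :: nat
  assumes k: "k > 0"
  defines "A \<equiv> {a \<in> topspace orbit_topology. a \<in> unit_orbit ` (PIdl\<^bsub>Zhat\<^esub> (diag k))}"
  shows "openin orbit_topology A" "closedin orbit_topology A"
proof -
  let ?B = "{x \<in> topspace Zhat_topology. unit_orbit x \<in> A}"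
  \<comment> \<open>The ideal is written as the coset of 0, so that the clopen coset lemma applies
    to the preimage of \<open>A\<close> under the quotient map.\<close>
  have "unit_orbit x \<in> A \<longleftrightarrow> x \<ominus>\<^bsub>Zhat\<^esub> diag 0 \<in> PIdl\<^bsub>Zhat\<^esub> (diag k)"
    if "x \<in> carrier Zhat" for x
    using that by (simp add: A_def orbit_topology_def unit_orbit_mem_PIdl_iff
        minus_diag_mem_PIdl_iff mem_PIdl_diag_iff)
  then have "?B = {z \<in> carrier Zhat. z \<ominus>\<^bsub>Zhat\<^esub> diag 0 \<in> PIdl\<^bsub>Zhat\<^esub> (diag k)}"
    by auto
  then have "openin Zhat_topology ?B" "closedin Zhat_topology ?B"
    using clopen_diag_coset[OF k, of 0] by simp_all
  moreover have q: "quotient_map Zhat_topology orbit_topology unit_orbit"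
    unfolding orbit_topology_def by (rule quotient_map_quotient_topology)
  moreover have "A \<subseteq> topspace orbit_topology"
    by (auto simp: A_def)
  ultimately show "openin orbit_topology A" "closedin orbit_topology A"
    using q[unfolded quotient_map_def] q[unfolded quotient_map_closedin] by blast+
qed

text \<open>\<open>T\<close> is the condition that (m, k) imposes on r, and it is a basic open set
  with threshold m. Its complement is the basic set of the complementary coset together with the
  isolated points below m.\<close>

lemma clopen_Nbar_coset:
  fixes k m :: nat
  assumes k: "k > 0"
  defines "U \<equiv> {z \<in> carrier Zhat. z \<ominus>\<^bsub>Zhat\<^esub> diag m \<in> PIdl\<^bsub>Zhat\<^esub> (diag k)}"
  defines "T \<equiv> Inl ` {n. n \<ge> m \<and> diag n \<in> U} \<union> Inr ` U"
  shows "openin Nbar_topology T" "closedin Nbar_topology T"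
proof -
  have base: "openin Nbar_topology (Inl ` {n. n \<ge> n0 \<and> diag n \<in> V} \<union> Inr ` V)"
    if "openin Zhat_topology V" for n0 V
    unfolding Nbar_topology_def using that by (intro topology_generated_by_Basis) blast
  have single: "openin Nbar_topology {Inl n}" for n
    unfolding Nbar_topology_def by (intro topology_generated_by_Basis) blast
  have U: "openin Zhat_topology U" "openin Zhat_topology (carrier Zhat - U)"
    using clopen_diag_coset[OF k, of m] unfolding U_def closedin_def by simp_all
  show "openin Nbar_topology T"
    unfolding T_def using U(1) by (rule base)
  have "topspace Nbar_topology - T =
      (Inl ` {n. n \<ge> 0 \<and> diag n \<in> carrier Zhat - U} \<union> Inr ` (carrier Zhat - U)) \<union> (\<Union>n\<in>{..<m}. {Inl n})"
    by (auto simp: T_def)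
  moreover have "openin Nbar_topology \<dots>"
    by (rule openin_Un[OF base[OF U(2)]]) (use single in blast)
  ultimately show "closedin Nbar_topology T"
    by (auto simp: closedin_def T_def U_def)
qed

section \<open>The map into the Nica spectrum\<close>

text \<open>Multiplying by x in the group turns the condition into y = x z with z in the semigroup,
  which is then read off componentwise.\<close>

lemma NN_le_iff:
  assumes "k > 0" "l > 0"
  shows "NN_le (m, k) (n, l) \<longleftrightarrow> m \<le> n \<and> k dvd n - m \<and> k dvd l"
proof -
  interpret group QQ by (rule group_QQ)
  have carr: "NN_incl x \<in> carrier QQ" if "x \<in> NN" for x
    using that by (auto simp: NN_incl_def QQ_def NN_def)
  have inj: "NN_incl x = NN_incl y \<longleftrightarrow> x = y" for x y
    by (cases x; cases y) (simp add: NN_incl_def)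
  have mem: "(m, k) \<in> NN" "(n, l) \<in> NN"
    using assms by (auto simp: NN_def)
  have "NN_le (m, k) (n, l) \<longleftrightarrow>
      (\<exists>x\<in>NN. inv\<^bsub>QQ\<^esub> (NN_incl (m, k)) \<otimes>\<^bsub>QQ\<^esub> NN_incl (n, l) = NN_incl x)"
    by (simp add: NN_le_def image_iff)
  also have "\<dots> \<longleftrightarrow> (\<exists>x\<in>NN. NN_incl (n, l) = NN_incl (m, k) \<otimes>\<^bsub>QQ\<^esub> NN_incl x)"
    using inv_solve_left'[OF carr carr carr] mem by blast
  also have "\<dots> \<longleftrightarrow> (\<exists>i j. j > 0 \<and> n = m + k * i \<and> l = k * j)"
    by (auto simp: NN_def NN_incl_mult inj)
  also have "\<dots> \<longleftrightarrow> m \<le> n \<and> k dvd n - m \<and> k dvd l"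
  proof
    assume "m \<le> n \<and> k dvd n - m \<and> k dvd l"
    then obtain i j where "m \<le> n" "n - m = k * i" "l = k * j"
      by (auto elim!: dvdE)
    then show "\<exists>i j. j > 0 \<and> n = m + k * i \<and> l = k * j"
      using assms by (intro exI[of _ i] exI[of _ j]) auto
  qed auto
  finally show ?thesis .
qed

lemma mem_Nica_p_Inl:
  assumes "x \<in> carrier Zhat"
  shows "(m, k) \<in> Nica_p (Inl n, unit_orbit x) \<longleftrightarrow>
    k > 0 \<and> x \<in> PIdl\<^bsub>Zhat\<^esub> (diag k) \<and> m \<le> n \<and> k dvd n - m"
proof -
  have "(\<exists>j::nat. int n - int m = int k * int j) \<longleftrightarrow> m \<le> n \<and> k dvd n - m"
  proof
    assume "\<exists>j::nat. int n - int m = int k * int j"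
    then obtain j where "int n = int (m + k * j)"
      by (auto simp: algebra_simps)
    then have "n = m + k * j"
      by (simp only: of_nat_eq_iff)
    then show "m \<le> n \<and> k dvd n - m"
      by simp
  next
    assume "m \<le> n \<and> k dvd n - m"
    then obtain j where "m \<le> n" "n - m = k * j"
      by (auto elim!: dvdE)
    then have "int n - int m = int k * int j"
      by (metis of_nat_diff of_nat_mult)
    then show "\<exists>j::nat. int n - int m = int k * int j" ..
  qed
  then show ?thesis
    using unit_orbit_mem_PIdl_iff[OF assms, of k] by (auto simp: Nica_p_def NN_def)
qed

lemma mem_Nica_p_Inr:
  assumes "x \<in> carrier Zhat"
  shows "(m, k) \<in> Nica_p (Inr z, unit_orbit x) \<longleftrightarrow>
    k > 0 \<and> x \<in> PIdl\<^bsub>Zhat\<^esub> (diag k) \<and> z \<ominus>\<^bsub>Zhat\<^esub> diag m \<in> PIdl\<^bsub>Zhat\<^esub> (diag k)"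
  using unit_orbit_mem_PIdl_iff[OF assms, of k] by (auto simp: Nica_p_def NN_def)

lemma param_cases:
  assumes "s \<in> topspace param_topology"
  obtains n x where "s = (Inl n, unit_orbit x)" "x \<in> carrier Zhat"
  | z x where "s = (Inr z, unit_orbit x)" "z \<in> carrier Zhat" "x \<in> carrier Zhat"
  using assms unfolding topspace_param by blast

lemma PIdl_diag_lcm:
  assumes "x \<in> carrier Zhat" "k > 0" "l > 0"
    and "x \<in> PIdl\<^bsub>Zhat\<^esub> (diag k)" "x \<in> PIdl\<^bsub>Zhat\<^esub> (diag l)"
  shows "x \<in> PIdl\<^bsub>Zhat\<^esub> (diag (lcm k l))"
  using assms prime_power_dvd_lcm[of _ _ k l] unfolding mem_PIdl_diag_iff[OF assms(1)] by blast

lemma minus_diag_mem_PIdl_mono: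
  assumes z: "z \<in> carrier Zhat" and mem: "z \<ominus>\<^bsub>Zhat\<^esub> diag m \<in> PIdl\<^bsub>Zhat\<^esub> (diag k)"
    and l: "l dvd k" "int l dvd int m - int n"
  shows "z \<ominus>\<^bsub>Zhat\<^esub> diag n \<in> PIdl\<^bsub>Zhat\<^esub> (diag l)"
  unfolding minus_diag_mem_PIdl_iff[OF z]
proof (intro allI impI)
  fix p i assume p: "prime p" "p ^ i dvd l"
  have "z p i = int m mod int p ^ i"
    using mem p l(1) unfolding minus_diag_mem_PIdl_iff[OF z] by (meson dvd_trans)
  moreover have "int p ^ i dvd int m - int n"
    using p(2) l(2) by (metis dvd_trans of_nat_dvd_iff of_nat_power)
  ultimately show "z p i = int n mod int p ^ i"
    by (simp add: mod_eq_dvd_iff)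
qed

lemma minus_diag_mem_PIdl_cong:
  assumes z: "z \<in> carrier Zhat"
    and "z \<ominus>\<^bsub>Zhat\<^esub> diag m \<in> PIdl\<^bsub>Zhat\<^esub> (diag k)" "z \<ominus>\<^bsub>Zhat\<^esub> diag n \<in> PIdl\<^bsub>Zhat\<^esub> (diag k)"
    and k: "k > 0"
  shows "int k dvd int m - int n"
proof -
  have "diag m \<ominus>\<^bsub>Zhat\<^esub> diag n \<in> PIdl\<^bsub>Zhat\<^esub> (diag k)"
    using assms(2,3) by (simp add: minus_diag_mem_PIdl_iff z diag_component)
  then show ?thesis
    by (simp add: diag_minus_diag_mem_PIdl_iff k)
qed

text \<open>Modulus 1 removes every arithmetic condition and leaves only the order. These elements
  recover n in type A and tell the two types apart.\<close>

lemma mem_Nica_p_one: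
  assumes "x \<in> carrier Zhat"
  shows "(m, 1) \<in> Nica_p (Inl n, unit_orbit x) \<longleftrightarrow> m \<le> n"
    and "z \<in> carrier Zhat \<Longrightarrow> (m, 1) \<in> Nica_p (Inr z, unit_orbit x)"
proof -
  have one: "y p i = 0" if "y \<in> carrier Zhat" "prime p" "p ^ i dvd 1" for y p i
  proof -
    have "i = 0"
      using that(2,3) by (metis is_unit_power_iff not_prime_unit)
    then show ?thesis
      using Zp_reduce[OF Zhat_component[OF that(1,2)], of 0 0] by simp
  qed
  have x: "x \<in> PIdl\<^bsub>Zhat\<^esub> (diag 1)"
    using one[OF assms] by (simp add: mem_PIdl_diag_iff assms)
  then show "(m, 1) \<in> Nica_p (Inl n, unit_orbit x) \<longleftrightarrow> m \<le> n"
    by (simp add: mem_Nica_p_Inl assms)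
  assume z: "z \<in> carrier Zhat"
  interpret cring Zhat by (rule cring_Zhat)
  have "z \<ominus>\<^bsub>Zhat\<^esub> diag m \<in> PIdl\<^bsub>Zhat\<^esub> (diag 1)"
    using one[of "z \<ominus>\<^bsub>Zhat\<^esub> diag m"] z by (simp add: mem_PIdl_diag_iff)
  then show "(m, 1) \<in> Nica_p (Inr z, unit_orbit x)"
    using x by (simp add: mem_Nica_p_Inr assms)
qed

lemma hereditaryI:
  assumes "\<omega> \<subseteq> NN"
    and "\<And>m k m' k'. (m, k) \<in> \<omega> \<Longrightarrow> k' > 0 \<Longrightarrow> m' \<le> m \<Longrightarrow> k' dvd m - m' \<Longrightarrow> k' dvd k \<Longrightarrow> (m', k') \<in> \<omega>"
  shows "hereditary \<omega>"
  unfolding hereditary_def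
proof (intro ballI impI)
  fix x y assume *: "y \<in> \<omega>" "x \<in> NN" "NN_le x y"
  obtain m k m' k' where eq: "y = (m, k)" "x = (m', k')"
    by (cases x; cases y)
  have "k > 0" "k' > 0"
    using * assms(1) by (auto simp: eq NN_def)
  then show "x \<in> \<omega>"
    using assms(2)[of m k k' m'] * by (simp add: eq NN_le_iff)
qed

text \<open>Any upper bound has a second component divisible by k and k', so the lcm is the
  economical choice and only a first component has to be found.\<close>

lemma directedI:
  assumes "\<omega> \<subseteq> NN"
    and "\<And>m k m' k'. (m, k) \<in> \<omega> \<Longrightarrow> (m', k') \<in> \<omega> \<Longrightarrow>
      \<exists>n. (n, lcm k k') \<in> \<omega> \<and> m \<le> n \<and> k dvd n - m \<and> m' \<le> n \<and> k' dvd n - m'"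
  shows "directed \<omega>"
  unfolding directed_def
proof (intro ballI)
  fix x y assume *: "x \<in> \<omega>" "y \<in> \<omega>"
  obtain m k m' k' where eq: "x = (m, k)" "y = (m', k')"
    by (cases x; cases y)
  have pos: "k > 0" "k' > 0"
    using * assms(1) by (auto simp: eq NN_def)
  obtain n where "(n, lcm k k') \<in> \<omega>" "m \<le> n" "k dvd n - m" "m' \<le> n" "k' dvd n - m'"
    using assms(2)[of m k m' k'] * unfolding eq by blast
  then show "\<exists>z\<in>\<omega>. NN_le x z \<and> NN_le y z"
    using pos by (intro bexI[of _ "(n, lcm k k')"]) (simp_all add: eq NN_le_iff lcm_pos_nat)
qed

text \<open>For directedness, type A uses n itself as first component of the bound. Type B uses a
  natural number above m and m' that approximates z modulo the lcm, hence is congruent to m modulo k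
  and to m' modulo k'.\<close>

lemma Nica_p_in_spectrum:
  assumes "s \<in> topspace param_topology"
  shows "Nica_p s \<in> Nica_spectrum"
  using assms
proof (cases rule: param_cases)
  case (1 n x)
  note mem = mem_Nica_p_Inl[OF 1(2)]
  have NN: "Nica_p s \<subseteq> NN"
    by (auto simp: 1(1) mem NN_def)
  have "hereditary (Nica_p s)"
  proof (rule hereditaryI[OF NN])
    fix m k m' k'
    assume *: "(m, k) \<in> Nica_p s" "k' > 0" "m' \<le> m" "k' dvd m - m'" "k' dvd k"
    then have mk: "x \<in> PIdl\<^bsub>Zhat\<^esub> (diag k)" "m \<le> n" "k dvd n - m"
      by (simp_all add: 1(1) mem)
    have "x \<in> PIdl\<^bsub>Zhat\<^esub> (diag k')"
      using mk(1) *(5) unfolding mem_PIdl_diag_iff[OF 1(2)] by (meson dvd_trans)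
    moreover have "k' dvd (n - m) + (m - m')"
      using mk(3) *(4,5) by (meson dvd_add dvd_trans)
    ultimately show "(m', k') \<in> Nica_p s"
      using *(2,3) mk(2) by (simp add: 1(1) mem)
  qed
  moreover have "directed (Nica_p s)"
  proof (rule directedI[OF NN])
    fix m k m' k' assume "(m, k) \<in> Nica_p s" "(m', k') \<in> Nica_p s"
    then show "\<exists>a. (a, lcm k k') \<in> Nica_p s \<and> m \<le> a \<and> k dvd a - m \<and> m' \<le> a \<and> k' dvd a - m'"
      using PIdl_diag_lcm[OF 1(2)] by (intro exI[of _ n]) (simp add: 1(1) mem lcm_pos_nat)
  qed
  moreover have "(0, 1) \<in> Nica_p s"
    unfolding 1(1) mem_Nica_p_one(1)[OF 1(2)] by simp
  ultimately show ?thesis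
    using NN by (auto simp: Nica_spectrum_def)
next
  case (2 z x)
  note mem = mem_Nica_p_Inr[OF 2(3)]
  have NN: "Nica_p s \<subseteq> NN"
    by (auto simp: 2(1) mem NN_def)
  have "hereditary (Nica_p s)"
  proof (rule hereditaryI[OF NN])
    fix m k m' k'
    assume *: "(m, k) \<in> Nica_p s" "k' > 0" "m' \<le> m" "k' dvd m - m'" "k' dvd k"
    then have mk: "x \<in> PIdl\<^bsub>Zhat\<^esub> (diag k)" "z \<ominus>\<^bsub>Zhat\<^esub> diag m \<in> PIdl\<^bsub>Zhat\<^esub> (diag k)"
      by (simp_all add: 2(1) mem)
    have "x \<in> PIdl\<^bsub>Zhat\<^esub> (diag k')"
      using mk(1) *(5) unfolding mem_PIdl_diag_iff[OF 2(3)] by (meson dvd_trans)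
    moreover have "int k' dvd int m - int m'"
      using *(3,4) by (metis of_nat_diff of_nat_dvd_iff)
    then have "z \<ominus>\<^bsub>Zhat\<^esub> diag m' \<in> PIdl\<^bsub>Zhat\<^esub> (diag k')"
      by (rule minus_diag_mem_PIdl_mono[OF 2(2) mk(2) *(5)])
    ultimately show "(m', k') \<in> Nica_p s"
      using *(2) by (simp add: 2(1) mem)
  qed
  moreover have "directed (Nica_p s)"
  proof (rule directedI[OF NN])
    fix m k m' k' assume "(m, k) \<in> Nica_p s" "(m', k') \<in> Nica_p s"
    then have *: "0 < k" "x \<in> PIdl\<^bsub>Zhat\<^esub> (diag k)" "z \<ominus>\<^bsub>Zhat\<^esub> diag m \<in> PIdl\<^bsub>Zhat\<^esub> (diag k)"
      "0 < k'" "x \<in> PIdl\<^bsub>Zhat\<^esub> (diag k')" "z \<ominus>\<^bsub>Zhat\<^esub> diag m' \<in> PIdl\<^bsub>Zhat\<^esub> (diag k')"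
      by (simp_all add: 2(1) mem)
    have pos: "lcm k k' > 0"
      using * by (simp add: lcm_pos_nat)
    obtain a where a: "a \<ge> max m m'" "z \<ominus>\<^bsub>Zhat\<^esub> diag a \<in> PIdl\<^bsub>Zhat\<^esub> (diag (lcm k k'))"
      using ex_nat_approx[OF 2(2) pos] by blast
    have "z \<ominus>\<^bsub>Zhat\<^esub> diag a \<in> PIdl\<^bsub>Zhat\<^esub> (diag k)" "z \<ominus>\<^bsub>Zhat\<^esub> diag a \<in> PIdl\<^bsub>Zhat\<^esub> (diag k')"
      using minus_diag_mem_PIdl_mono[OF 2(2) a(2)] by simp_all
    then have "int k dvd int a - int m" "int k' dvd int a - int m'"
      using * minus_diag_mem_PIdl_cong[OF 2(2)] by blast+
    then have "k dvd a - m" "k' dvd a - m'"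
      using a(1) by (metis max.bounded_iff of_nat_diff of_nat_dvd_iff)+
    then show "\<exists>a. (a, lcm k k') \<in> Nica_p s \<and> m \<le> a \<and> k dvd a - m \<and> m' \<le> a \<and> k' dvd a - m'"
      using pos a PIdl_diag_lcm[OF 2(3)] * by (intro exI[of _ a]) (simp add: 2(1) mem)
  qed
  moreover have "(0, 1) \<in> Nica_p s"
    unfolding 2(1) by (rule mem_Nica_p_one(2)[OF 2(3,2)])
  ultimately show ?thesis
    using NN by (auto simp: Nica_spectrum_def)
qed

text \<open>For pointwise convergence it suffices to treat one element (m, k) at a time; the
  parameters whose image contains it form a clopen rectangle, one side for r and one for a.\<close>

lemma continuous_map_Nica_p: "continuous_map param_topology Nica_topology Nica_p"
  unfolding Nica_topology_def
proof (rule continuous_map_pullback')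
  show "topspace param_topology \<subseteq> Nica_p -` Nica_spectrum"
    using Nica_p_in_spectrum by blast
  have "continuous_map param_topology (discrete_topology UNIV) (\<lambda>s. i \<in> Nica_p s)" if "i \<in> NN" for i
  proof -
    obtain m k where i: "i = (m, k)"
      by (cases i)
    have k: "k > 0"
      using that by (simp add: i NN_def)
    define U where "U = {z \<in> carrier Zhat. z \<ominus>\<^bsub>Zhat\<^esub> diag m \<in> PIdl\<^bsub>Zhat\<^esub> (diag k)}"
    define T :: "(nat + zhat) set" where "T = Inl ` {n. n \<ge> m \<and> diag n \<in> U} \<union> Inr ` U"
    define A where "A = {a \<in> topspace orbit_topology. a \<in> unit_orbit ` (PIdl\<^bsub>Zhat\<^esub> (diag k))}"
    have "s \<in> T \<times> A \<longleftrightarrow> s \<in> topspace param_topology \<and> i \<in> Nica_p s" for s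
    proof (cases "s \<in> topspace param_topology")
      case True
      then show ?thesis
      proof (cases rule: param_cases)
        case (1 n x)
        have "m \<le> n \<Longrightarrow> int k dvd int n - int m \<longleftrightarrow> k dvd n - m"
          by (metis of_nat_diff of_nat_dvd_iff)
        then have "Inl n \<in> T \<longleftrightarrow> m \<le> n \<and> k dvd n - m"
          by (auto simp: T_def U_def diag_minus_diag_mem_PIdl_iff k)
        moreover have "unit_orbit x \<in> A \<longleftrightarrow> x \<in> PIdl\<^bsub>Zhat\<^esub> (diag k)"
          by (simp add: A_def orbit_topology_def unit_orbit_mem_PIdl_iff 1(2))
        ultimately show ?thesis
          using True by (auto simp: 1(1) i k mem_Nica_p_Inl 1(2))
      next
        case (2 z x)
        have "Inr z \<in> T \<longleftrightarrow> z \<ominus>\<^bsub>Zhat\<^esub> diag m \<in> PIdl\<^bsub>Zhat\<^esub> (diag k)"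
          using 2(2) by (auto simp: T_def U_def)
        moreover have "unit_orbit x \<in> A \<longleftrightarrow> x \<in> PIdl\<^bsub>Zhat\<^esub> (diag k)"
          by (simp add: A_def orbit_topology_def unit_orbit_mem_PIdl_iff 2(3))
        ultimately show ?thesis
          using True by (auto simp: 2(1) i k mem_Nica_p_Inr 2(3))
      qed
    next
      case False
      then show ?thesis
        by (cases s) (auto simp: topspace_param T_def U_def A_def orbit_topology_def)
    qed
    then have "{s \<in> topspace param_topology. i \<in> Nica_p s} = T \<times> A"
      by blast
    moreover have "openin param_topology (T \<times> A)" "closedin param_topology (T \<times> A)"
      using clopen_Nbar_coset[OF k, of m] clopen_orbit_PIdl[OF k]
      by (simp_all add: param_topology_def openin_prod_Times_iff closedin_prod_Times_iff T_def U_def A_def)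
    ultimately show ?thesis
      by (intro clopen_imp_continuous_map_discrete) simp_all
  qed
  then show "continuous_map param_topology (product_topology (\<lambda>_. discrete_topology UNIV) NN)
      ((\<lambda>\<omega>. \<lambda>x\<in>NN. x \<in> \<omega>) \<circ> Nica_p)"
    by (auto simp: continuous_map_componentwise)
qed

lemma Hausdorff_space_Nica: "Hausdorff_space Nica_topology"
  unfolding Hausdorff_space_def
proof (intro allI impI, elim conjE)
  fix \<omega> \<eta> assume *: "\<omega> \<in> topspace Nica_topology" "\<eta> \<in> topspace Nica_topology" "\<omega> \<noteq> \<eta>"
  then have "\<omega> \<subseteq> NN" "\<eta> \<subseteq> NN"
    by (auto simp: Nica_spectrum_def)
  then obtain x where x: "x \<in> NN" "(x \<in> \<omega>) \<noteq> (x \<in> \<eta>)"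
    using *(3) by blast
  have "continuous_map Nica_topology (discrete_topology UNIV) ((\<lambda>f. f x) \<circ> (\<lambda>\<omega>. \<lambda>x\<in>NN. x \<in> \<omega>))"
    unfolding Nica_topology_def
    using continuous_map_product_projection[OF x(1), of "\<lambda>_. discrete_topology UNIV"]
    by (rule continuous_map_pullback)
  then have "continuous_map Nica_topology (discrete_topology UNIV) (\<lambda>\<omega>. x \<in> \<omega>)"
    using x(1) by (simp add: o_def)
  note op = conjunct1[OF clopen_vimage_discrete[OF this]]
  \<comment> \<open>Here \<open>{x \<in> \<omega>}\<close> is the singleton of a truth value: the
    two open sets consist of the \<xi> that agree at x with \<omega> and with \<eta>,
    respectively.\<close>
  show "\<exists>U V. openin Nica_topology U \<and> openin Nica_topology V \<and> \<omega> \<in> U \<and> \<eta> \<in> V \<and> disjnt U V"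
    using op[of "{x \<in> \<omega>}"] op[of "{x \<in> \<eta>}"] * x(2)
    by (intro exI[of _ "{\<xi> \<in> topspace Nica_topology. (x \<in> \<xi>) \<in> {x \<in> \<omega>}}"]
        exI[of _ "{\<xi> \<in> topspace Nica_topology. (x \<in> \<xi>) \<in> {x \<in> \<eta>}}"]) (auto simp: disjnt_iff)
qed

section \<open>Surjectivity by density of the principal sets\<close>

lemma NN_le_trans:
  assumes "x \<in> NN" "y \<in> NN" "z \<in> NN" "NN_le x y" "NN_le y z"
  shows "NN_le x z"
proof -
  obtain a b c d e f where eq: "x = (a, b)" "y = (c, d)" "z = (e, f)" "b > 0" "d > 0" "f > 0"
    using assms(1-3) by (auto simp: NN_def)
  have le: "a \<le> c" "b dvd c - a" "b dvd d" "c \<le> e" "d dvd e - c" "d dvd f"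
    using assms(4,5) by (simp_all add: eq NN_le_iff)
  have "b dvd (e - c) + (c - a)"
    using le by (meson dvd_add dvd_trans)
  then show ?thesis
    using le by (auto simp: eq NN_le_iff intro: dvd_trans)
qed

lemma directed_finite_bound:
  assumes "\<omega> \<in> Nica_spectrum" "finite F" "F \<subseteq> \<omega>"
  shows "\<exists>z\<in>\<omega>. \<forall>x\<in>F. NN_le x z"
  using assms(2,3)
proof (induction F rule: finite_induct)
  case empty
  then show ?case
    using assms(1) by (auto simp: Nica_spectrum_def)
next
  case (insert x F)
  then obtain z where z: "z \<in> \<omega>" "\<forall>y\<in>F. NN_le y z"
    by auto
  obtain w where w: "w \<in> \<omega>" "NN_le x w" "NN_le z w"
    using assms(1) insert.prems z(1) unfolding Nica_spectrum_def directed_def by blast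
  have "\<omega> \<subseteq> NN"
    using assms(1) by (simp add: Nica_spectrum_def)
  then have "NN_le y w" if "y \<in> F" for y
    using NN_le_trans[of y z w] that z w insert.prems by blast
  then show ?case
    using w by blast
qed

lemma Nica_p_diag:
  assumes "k > 0"
  shows "Nica_p (Inl n, unit_orbit (diag k)) = {x \<in> NN. NN_le x (n, k)}"
  using assms by (auto simp: mem_Nica_p_Inl diag_mem_PIdl_diag_iff NN_le_iff NN_def)

lemma Nica_p_surj: "Nica_p ` topspace param_topology = Nica_spectrum"
proof
  show "Nica_p ` topspace param_topology \<subseteq> Nica_spectrum"
    using Nica_p_in_spectrum by blast
  have "compactin Nica_topology (Nica_p ` topspace param_topology)"
    using compact_space_param continuous_map_Nica_p unfolding compact_space_def by (rule image_compactin)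
  then have "closedin Nica_topology (Nica_p ` topspace param_topology)"
    by (rule compactin_imp_closedin[OF Hausdorff_space_Nica])
  then have op: "openin Nica_topology (Nica_spectrum - Nica_p ` topspace param_topology)"
    by (simp add: closedin_def)
  let ?f = "\<lambda>\<omega>. \<lambda>x\<in>NN. x \<in> (\<omega> :: (nat \<times> nat) set)"
  let ?P = "product_topology (\<lambda>_. discrete_topology (UNIV :: bool set)) NN"
  obtain V where V: "openin ?P V"
      "Nica_spectrum - Nica_p ` topspace param_topology = ?f -` V \<inter> Nica_spectrum"
    using op unfolding Nica_topology_def openin_pullback_topology by blast
  show "Nica_spectrum \<subseteq> Nica_p ` topspace param_topology"
  proof (rule ccontr)
    assume "\<not> Nica_spectrum \<subseteq> Nica_p ` topspace param_topology"
    then obtain \<omega> where \<omega>: "\<omega> \<in> Nica_spectrum" "?f \<omega> \<in> V"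
      using V(2) by blast
    then obtain U where U: "finite {i \<in> NN. U i \<noteq> topspace (discrete_topology (UNIV :: bool set))}"
        "?f \<omega> \<in> Pi\<^sub>E NN U" "Pi\<^sub>E NN U \<subseteq> V"
      using V(1) unfolding openin_product_topology_alt by blast
    \<comment> \<open>Only constrained elements inside \<omega> need to lie below (n, k). Those
      outside \<omega> stay outside \<open>Nica_p s\<close>, because heredity gives
      \<open>Nica_p s \<subseteq> \<omega>\<close>.\<close>
    define F where "F = {i \<in> NN. U i \<noteq> UNIV} \<inter> \<omega>"
    have F: "finite F" "F \<subseteq> \<omega>"
      using U(1) by (simp_all add: F_def)
    obtain n k where nk: "(n, k) \<in> \<omega>" "\<forall>x\<in>F. NN_le x (n, k)"
      using directed_finite_bound[OF \<omega>(1) F] by auto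
    have k: "k > 0"
      using \<omega>(1) nk(1) by (auto simp: Nica_spectrum_def NN_def)
    define s :: "(nat + zhat) \<times> zhat set" where "s = (Inl n, unit_orbit (diag k))"
    have s: "s \<in> topspace param_topology"
      by (simp add: s_def topspace_param)
    have "Nica_p s \<subseteq> \<omega>"
      using \<omega>(1) nk(1) by (auto simp: s_def Nica_p_diag[OF k] Nica_spectrum_def hereditary_def)
    moreover have "F \<subseteq> Nica_p s"
      using nk(2) by (auto simp: s_def Nica_p_diag[OF k] F_def)
    ultimately have agree: "i \<in> Nica_p s \<longleftrightarrow> i \<in> \<omega>" if "i \<in> NN" "U i \<noteq> UNIV" for i
      using that by (auto simp: F_def)
    have "?f (Nica_p s) i \<in> U i" if "i \<in> NN" for i
    proof (cases "U i = UNIV")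
      case False
      have "?f \<omega> i \<in> U i"
        using U(2) that by (rule PiE_mem)
      then show ?thesis
        using agree[OF that False] that by simp
    qed simp
    then have "?f (Nica_p s) \<in> Pi\<^sub>E NN U"
      by (simp add: PiE_iff)
    then have "Nica_p s \<in> Nica_spectrum - Nica_p ` topspace param_topology"
      using U(3) V(2) Nica_p_in_spectrum[OF s] by blast
    then show False
      using s by blast
  qed
qed

section \<open>Injectivity up to the equivalence relation\<close>

lemma mem_PIdl_diag_prime_power_iff:
  assumes x: "x \<in> carrier Zhat" and p: "prime p"
  shows "x \<in> PIdl\<^bsub>Zhat\<^esub> (diag (p ^ i)) \<longleftrightarrow> x p i = 0"
proof
  assume "x \<in> PIdl\<^bsub>Zhat\<^esub> (diag (p ^ i))"
  then show "x p i = 0"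
    using p by (simp add: mem_PIdl_diag_iff[OF x])
next
  assume 0: "x p i = 0"
  \<comment> \<open>Unless j = 0, where the coordinate vanishes anyway, divisibility forces q = p
    and j <= i, and then the coordinate is a reduction of \<open>x p i\<close>.\<close>
  have "x q j = 0" if q: "prime q" "q ^ j dvd p ^ i" for q j
  proof (cases "j = 0")
    case True
    then show ?thesis
      using Zp_reduce[OF Zhat_component[OF x q(1)], of 0 0] by simp
  next
    case False
    then have "q dvd p ^ i"
      using q(2) by (meson dvd_power dvd_trans neq0_conv)
    then have "q = p"
      using q(1) p by (meson prime_dvd_power primes_dvd_imp_eq)
    then have "j \<le> i"
      using q(2) prime_gt_1_nat[OF p] by (simp add: power_dvd_imp_le)
    then show ?thesis
      using Zp_reduce[OF Zhat_component[OF x p] \<open>j \<le> i\<close>] 0 \<open>q = p\<close>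
        Zp_eq_0_iff[OF Zhat_component[OF x p] \<open>j \<le> i\<close>] by simp
  qed
  then show "x \<in> PIdl\<^bsub>Zhat\<^esub> (diag (p ^ i))"
    by (simp add: mem_PIdl_diag_iff[OF x])
qed

text \<open>Forgetting first components forgets r: what is left is the set of k dividing a. A
  witness m is n itself in type A and an approximation of z modulo k in type B.\<close>

lemma Nica_p_ideal:
  assumes "(r, unit_orbit x) \<in> topspace param_topology" "x \<in> carrier Zhat" "k > 0"
  shows "(\<exists>m. (m, k) \<in> Nica_p (r, unit_orbit x)) \<longleftrightarrow> x \<in> PIdl\<^bsub>Zhat\<^esub> (diag k)"
proof (cases r)
  case (Inl n)
  then show ?thesis
    using assms(2,3) by (auto simp: mem_Nica_p_Inl intro: exI[of _ n])
next
  case (Inr z)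
  then have "z \<in> carrier Zhat"
    using assms(1) by (auto simp: topspace_param)
  then show ?thesis
    using ex_nat_approx[of z k] assms(2,3) by (auto simp: Inr mem_Nica_p_Inr)
qed

lemma Nica_p_eq_imp_orbit_eq:
  assumes s: "(r, unit_orbit x) \<in> topspace param_topology" "x \<in> carrier Zhat"
    and t: "(r', unit_orbit x') \<in> topspace param_topology" "x' \<in> carrier Zhat"
    and eq: "Nica_p (r, unit_orbit x) = Nica_p (r', unit_orbit x')"
  shows "unit_orbit x = unit_orbit x'"
proof -
  have "x p i = 0 \<longleftrightarrow> x' p i = 0" if p: "prime p" for p i
    using Nica_p_ideal[OF s, of "p ^ i"] Nica_p_ideal[OF t, of "p ^ i"] eq prime_gt_0_nat[OF p]
    by (simp add: mem_PIdl_diag_prime_power_iff p s t)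
  then show ?thesis
    by (simp add: unit_orbit_eq_iff s t)
qed

lemma Nica_p_eq_imp_rel:
  assumes s: "s \<in> topspace param_topology" and t: "t \<in> topspace param_topology"
    and eq: "Nica_p s = Nica_p t"
  shows "(s, t) \<in> param_rel"
  using s
proof (cases rule: param_cases)
  case (1 n x)
  show ?thesis
    using t
  proof (cases rule: param_cases)
    case (1 n' x')
    note t' = this
    have "m \<le> n \<longleftrightarrow> m \<le> n'" for m
      using eq mem_Nica_p_one(1) \<open>s = (Inl n, unit_orbit x)\<close> \<open>x \<in> carrier Zhat\<close> t' by metis
    then have "n = n'"
      by (metis le_antisym order_refl)
    moreover have "unit_orbit x = unit_orbit x'"
      using Nica_p_eq_imp_orbit_eq s t eq \<open>s = (Inl n, unit_orbit x)\<close> \<open>x \<in> carrier Zhat\<close> t' by blast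
    ultimately show ?thesis
      using s t t' \<open>s = (Inl n, unit_orbit x)\<close> by (simp add: param_rel_def)
  next
    case (2 z' x')
    \<comment> \<open>A type B set contains every \<open>(m, 1)\<close>, in particular the one with
      m = Suc n, which the type A set excludes.\<close>
    then have "Suc n \<le> n"
      using eq mem_Nica_p_one 1 by metis
    then show ?thesis by simp
  qed
next
  case (2 z x)
  note s' = this
  show ?thesis
    using t
  proof (cases rule: param_cases)
    case (1 n x')
    then have "Suc n \<le> n"
      using eq mem_Nica_p_one s' by metis
    then show ?thesis by simp
  next
    case (2 z' x')
    have orb: "unit_orbit x = unit_orbit x'"
      using Nica_p_eq_imp_orbit_eq s t eq s' 2 by blast
    interpret cring Zhat by (rule cring_Zhat)
    \<comment> \<open>Only coordinates where x vanishes are tested by the ideal of a. There p^i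
      divides a, so a natural m approximating z modulo p^i puts (m, p^i) into the common set, and
      this forces z' to have the same residue.\<close>
    have "(z \<ominus>\<^bsub>Zhat\<^esub> z') p i = 0" if p: "prime p" and x0: "x p i = 0" for p i
    proof -
      let ?k = "p ^ i"
      have k: "?k > 0"
        using p by (simp add: prime_gt_0_nat)
      obtain m where m: "z \<ominus>\<^bsub>Zhat\<^esub> diag m \<in> PIdl\<^bsub>Zhat\<^esub> (diag ?k)"
        using ex_nat_approx[OF s'(2) k] by blast
      have "x \<in> PIdl\<^bsub>Zhat\<^esub> (diag ?k)"
        using x0 by (simp add: mem_PIdl_diag_prime_power_iff p s'(3))
      then have "(m, ?k) \<in> Nica_p (Inr z', unit_orbit x')"
        using m k eq unfolding s'(1) 2(1) by (metis mem_Nica_p_Inr[OF s'(3)])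
      then have "z' \<ominus>\<^bsub>Zhat\<^esub> diag m \<in> PIdl\<^bsub>Zhat\<^esub> (diag ?k)"
        unfolding mem_Nica_p_Inr[OF 2(3)] by blast
      then have "z p i = z' p i"
        using m p s'(2) 2(2) by (simp add: minus_diag_mem_PIdl_iff)
      then show ?thesis
        using p s'(2) 2(2) by (simp add: Zhat_minus_component)
    qed
    then have "z \<ominus>\<^bsub>Zhat\<^esub> z' \<in> orbit_ideal (unit_orbit x)"
      using s'(2,3) 2(2) by (simp add: orbit_ideal_unit_orbit mem_PIdl_iff)
    then show ?thesis
      using s t orb unfolding s'(1) 2(1) param_rel_def by blast
  qed
qed

theorem proposition1p1:
  shows "homeomorphic_map param_quotient_topology Nica_topology Nica_p_tilde"
proof (rule continuous_imp_homeomorphic_map)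
  let ?q = "\<lambda>s. param_rel `` {s}"
  \<comment> \<open>Continuity is checked after composing with the class map. The composite agrees
    with \<open>Nica_p\<close> on the topspace only: elsewhere the class is empty and
    \<open>the_elem\<close> has no meaningful value.\<close>
  show "continuous_map param_quotient_topology Nica_topology Nica_p_tilde"
    unfolding param_quotient_topology_def
    by (rule continuous_compose_quotient_map[OF quotient_map_quotient_topology])
      (rule continuous_map_eq[OF continuous_map_Nica_p], simp add: Nica_p_tilde_class)
  show "compact_space param_quotient_topology"
    unfolding param_quotient_topology_def
    by (rule compact_space_quotient_topology[OF compact_space_param])
  show "Hausdorff_space Nica_topology"
    by (rule Hausdorff_space_Nica)
  show "Nica_p_tilde ` topspace param_quotient_topology = topspace Nica_topology"
    by (simp add: param_quotient_topology_def image_image Nica_p_tilde_class Nica_p_surj)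
  show "inj_on Nica_p_tilde (topspace param_quotient_topology)"
  proof (clarsimp simp: inj_on_def param_quotient_topology_def Nica_p_tilde_class)
    fix s t assume "s \<in> topspace param_topology" "t \<in> topspace param_topology" "Nica_p s = Nica_p t"
    then show "?q s = ?q t"
      by (intro equiv_class_eq[OF equiv_param_rel] Nica_p_eq_imp_rel)
  qed
qed

end
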